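(* Let $\ell$ be a positive number and let $\Omega\subset\mathbb R^{n+1}_+$ be a backward time connected domain. Suppose that $v\in C^{m,2}_{x,t}(\overline{\Omega_\phi})$ solves the equation $$\partial_t^2v-A(x,\partial_x)v=0\quad\text{for all }(x,t)\in\Omega_\phi.$$ Then the functions $K_0v\in C^{m,2}_{x,t}(\Omega)$ and $K_1v\in C^{m,2}_{x,t}(\Omega)$ satisfy $$\left(\partial_t^2-t^\ell A(x,\partial_x)\right)K_0v=a_\ell\,t^{\frac{\ell}{2}-1}\,\partial_tv(x,0)\quad\text{for all }(x,t)\in\Omega,$$ $$\left(\partial_t^2-t^\ell A(x,\partial_x)\right)K_1v=b_\ell\,t^{\frac{\ell}{2}}\,\partial_tv(x,0)\quad\text{for all }(x,t)\in\Omega,$$ respectively. They have the following initial values for all $x\in\widetilde\Omega$: $$(K_0v)(x,0)=v(x,0),\quad (K_0v)_t(x,0)=0,\qquad (K_1v)(x,0)=0,\quad (K_1v)_t(x,0)=v(x,0).$$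
   Context: $\mathbb R^{n+1}_+=\{(x,t): x\in\mathbb R^n,\ t>0\}$. A set $\Omega\subseteq\overline{\mathbb R^{n+1}_+}$ is backward time (line-)connected (to $t=0$) if for every $(x,t)\in\Omega$ the segment $\{(x,s): s\in(0,t]\}$ is contained in $\Omega$. A domain is a connected open set. $\widetilde\Omega=\pi_x(\Omega)\subseteq\mathbb R^n$ is the projection of $\Omega$ to the $x$-space. $\phi(t)=\frac{2}{\ell+2}t^{(\ell+2)/2}$, $\gamma=\frac{\ell}{2(\ell+2)}$. The $\phi$-image of $\Omega$ is $\Omega_\phi=\bigcup_{(x,t)\in\Omega}\{(x,\tau):\tau\in(0,\phi(t)]\}$. $A(x,\partial_x)=\sum_{|\alpha|\le m}a_\alpha(x)\partial_x^\alpha$ is a linear partial differential operator of order $m$ in $x$ with coefficients $a_\alpha\in C^\infty(\widetilde\Omega)$. $C^{m,2}_{x,t}(\cdot)$ denotes functions continuous together with their partial derivatives up to order $m$ in $x$ and up to order $2$ in $t$ (on a closed set: extending continuously to it). Values at $t=0$ are understood by continuous extension. The operators are $$(K_0v)(x,t)=2^{2-2\gamma}\frac{\Gamma(2\gamma)}{\Gamma^2(\gamma)}\int_0^1v(x,\phi(t)s)(1-s^2)^{\gamma-1}ds,$$ $$(K_1v)(x,t)=t\,2^{2\gamma}\frac{\Gamma(2-2\gamma)}{\Gamma^2(1-\gamma)}\int_0^1v(x,\phi(t)s)(1-s^2)^{-\gamma}ds,$$ and the constants are $$a_\ell=2^{1-2\gamma}\frac{\ell\,\Gamma(2\gamma)}{2\gamma\,\Gamma^2(\gamma)},\qquad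 b_\ell=(\ell+2)2^{2\gamma-1}\frac{\Gamma(2-2\gamma)}{\Gamma^2(1-\gamma)}.$$ *)

theory Defs
  imports "HOL-Analysis.Analysis"
begin

text \<open>
  Points of space-time are pairs \<open>(x, t)\<close> of type \<open>(real^'n) \<times> real\<close>. Functions take values in a type
  of class \<open>{real_normed_field, euclidean_space}\<close>, which has \<open>real\<close> and \<open>complex\<close> as instances, so
  that the real- and the complex-valued case are both covered.
\<close>

section \<open>Partial derivatives and function spaces\<close>

definition dir_deriv :: "'e::real_normed_vector \<Rightarrow> ('e \<Rightarrow> 'k::real_normed_vector) \<Rightarrow> 'e \<Rightarrow> 'k" where
  "dir_deriv e f p = vector_derivative (\<lambda>h. f (p + h *\<^sub>R e)) (at 0)"

definition has_dir_deriv :: "'e::real_normed_vector \<Rightarrow> ('e \<Rightarrow> 'k::real_normed_vector) \<Rightarrow> 'e \<Rightarrow> bool" where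
  "has_dir_deriv e f p \<longleftrightarrow> (\<lambda>h. f (p + h *\<^sub>R e)) differentiable (at 0)"

definition iter_deriv :: "'e::real_normed_vector list \<Rightarrow> ('e \<Rightarrow> 'k::real_normed_vector) \<Rightarrow> 'e \<Rightarrow> 'k" where
  "iter_deriv es f = foldr dir_deriv es f"

text \<open>
  All iterated derivatives of \<open>f\<close> in the directions in \<open>E\<close>, of order up to \<open>k\<close> and taken in any
  order, exist and are continuous on the open set \<open>U\<close>.
\<close>
definition Ck_along ::
    "'e::real_normed_vector set \<Rightarrow> nat \<Rightarrow> 'e set \<Rightarrow> ('e \<Rightarrow> 'k::real_normed_vector) \<Rightarrow> bool" where
  "Ck_along E k U f \<longleftrightarrow>
     (\<forall>es\<in>lists E. length es \<le> k \<longrightarrow> continuous_on U (iter_deriv es f)) \<and>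
     (\<forall>es\<in>lists E. length es < k \<longrightarrow> (\<forall>e\<in>E. \<forall>p\<in>U. has_dir_deriv e (iter_deriv es f) p))"

definition smooth_on :: "(real^'n) set \<Rightarrow> (real^'n \<Rightarrow> 'k::real_normed_vector) \<Rightarrow> bool" where
  "smooth_on U f \<longleftrightarrow> (\<forall>k. Ck_along (range (\<lambda>i. axis i 1)) k U f)"

definition ex :: "'n \<Rightarrow> (real^'n::finite) \<times> real" where
  "ex i = (axis i 1, 0)"

definition et :: "(real^'n::finite) \<times> real" where
  "et = (0, 1)"

abbreviation partial_t ::
    "((real^'n) \<times> real \<Rightarrow> 'k::real_normed_vector) \<Rightarrow> (real^'n) \<times> real \<Rightarrow> 'k" where
  "partial_t \<equiv> dir_deriv et"

text \<open>
  \<open>C\<^sup>m\<^sup>,\<^sup>2\<close> in \<open>(x, t)\<close> on an open set: only pure derivatives are involved, of order up to \<open>m\<close> in \<open>x\<close>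
  and up to 2 in \<open>t\<close>, as is usual for anisotropic spaces such as \<open>C\<^sup>2\<^sup>,\<^sup>1\<close> in parabolic theory.
\<close>
definition Cm2 ::
    "nat \<Rightarrow> ((real^'n) \<times> real) set \<Rightarrow> ((real^'n) \<times> real \<Rightarrow> 'k::real_normed_vector) \<Rightarrow> bool" where
  "Cm2 m U f \<longleftrightarrow> Ck_along (range ex) m U f \<and> Ck_along {et} 2 U f"

definition extends_to_closure ::
    "'e::topological_space set \<Rightarrow> ('e \<Rightarrow> 'k::topological_space) \<Rightarrow> bool" where
  "extends_to_closure U f \<longleftrightarrow> (\<exists>g. continuous_on (closure U) g \<and> (\<forall>p\<in>U. g p = f p))"

text \<open>\<open>C\<^sup>m\<^sup>,\<^sup>2\<close> on the closure of the open set \<open>U\<close>; values of \<open>f\<close> outside \<open>U\<close> are irrelevant.\<close>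
definition Cm2_closure ::
    "nat \<Rightarrow> ((real^'n) \<times> real) set \<Rightarrow> ((real^'n) \<times> real \<Rightarrow> 'k::real_normed_vector) \<Rightarrow> bool" where
  "Cm2_closure m U f \<longleftrightarrow> Cm2 m U f \<and>
     (\<forall>es\<in>lists (range ex). length es \<le> m \<longrightarrow> extends_to_closure U (iter_deriv es f)) \<and>
     (\<forall>es\<in>lists {et}. length es \<le> 2 \<longrightarrow> extends_to_closure U (iter_deriv es f))"

text \<open>The value at \<open>(x, 0)\<close> of the continuous extension of \<open>f\<close> from \<open>U\<close>.\<close>
definition initial_value ::
    "((real^'n) \<times> real) set \<Rightarrow> ((real^'n) \<times> real \<Rightarrow> 'k::t2_space) \<Rightarrow> real^'n \<Rightarrow> 'k" where
  "initial_value U f x = Lim (at (x, 0) within U) f"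

section \<open>The operator \<open>A(x, \<partial>\<^sub>x)\<close>\<close>

text \<open>
  A multi-index is a function \<open>\<alpha> :: 'n \<Rightarrow> nat\<close>. The variables are differentiated in the order of some
  fixed enumeration of the index type; on \<open>C\<^sup>m\<close> functions the choice is immaterial for orders up
  to \<open>m\<close>, since mixed partial derivatives commute.
\<close>
definition enumeration :: "'n::finite list" where
  "enumeration = (SOME is. distinct is \<and> set is = UNIV)"

lemma enumeration: "distinct (enumeration :: 'n::finite list)" "set (enumeration :: 'n list) = UNIV"
proof -
  have "\<exists>is :: 'n list. distinct is \<and> set is = UNIV"
    using finite_distinct_list[OF finite[of "UNIV :: 'n set"]] by blast
  from someI_ex[OF this] show "distinct (enumeration :: 'n list)" "set (enumeration :: 'n list) = UNIV"
    unfolding enumeration_def by blast+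
qed

definition partial_x ::
    "('n \<Rightarrow> nat) \<Rightarrow> ((real^'n::finite) \<times> real \<Rightarrow> 'k::real_normed_vector) \<Rightarrow> (real^'n) \<times> real \<Rightarrow> 'k" where
  "partial_x \<alpha> f = iter_deriv (concat (map (\<lambda>i. replicate (\<alpha> i) (ex i)) enumeration)) f"

definition multi_indices :: "nat \<Rightarrow> ('n::finite \<Rightarrow> nat) set" where
  "multi_indices m = {\<alpha>. (\<Sum>i\<in>UNIV. \<alpha> i) \<le> m}"

lemma finite_multi_indices: "finite (multi_indices m :: ('n::finite \<Rightarrow> nat) set)"
proof (rule finite_subset)
  show "multi_indices m \<subseteq> PiE (UNIV :: 'n set) (\<lambda>_. {..m})"
  proof
    fix \<alpha> :: "'n \<Rightarrow> nat" assume "\<alpha> \<in> multi_indices m"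
    then have "\<alpha> i \<le> m" for i
      using member_le_sum[of i UNIV \<alpha>] by (simp add: multi_indices_def)
    then show "\<alpha> \<in> PiE UNIV (\<lambda>_. {..m})" by auto
  qed
  show "finite (PiE (UNIV :: 'n set) (\<lambda>_. {..m}))" by (rule finite_PiE) auto
qed

definition diff_op ::
    "nat \<Rightarrow> (('n \<Rightarrow> nat) \<Rightarrow> real^'n \<Rightarrow> 'k) \<Rightarrow>
     ((real^'n::finite) \<times> real \<Rightarrow> 'k::real_normed_field) \<Rightarrow> (real^'n) \<times> real \<Rightarrow> 'k" where
  "diff_op m a f p = (\<Sum>\<alpha>\<in>multi_indices m. a \<alpha> (fst p) * partial_x \<alpha> f p)"

section \<open>Domains\<close>

definition upper_half_space :: "((real^'n) \<times> real) set" where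
  "upper_half_space = {(x, t). 0 < t}"

definition backward_time_connected :: "((real^'n) \<times> real) set \<Rightarrow> bool" where
  "backward_time_connected \<Omega> \<longleftrightarrow> (\<forall>(x, t)\<in>\<Omega>. \<forall>s\<in>{0<..t}. (x, s) \<in> \<Omega>)"

definition phi :: "real \<Rightarrow> real \<Rightarrow> real" where
  "phi l t = 2 / (l + 2) * t powr ((l + 2) / 2)"

definition phi_image :: "real \<Rightarrow> ((real^'n) \<times> real) set \<Rightarrow> ((real^'n) \<times> real) set" where
  "phi_image l \<Omega> = (\<Union>(x, t)\<in>\<Omega>. {(x, \<tau>) | \<tau>. \<tau> \<in> {0<..phi l t}})"

section \<open>The integral operators\<close>

definition gam :: "real \<Rightarrow> real" where
  "gam l = l / (2 * (l + 2))"

definition K0 :: "real \<Rightarrow> ((real^'n) \<times> real \<Rightarrow> 'k::euclidean_space) \<Rightarrow> (real^'n) \<times> real \<Rightarrow> 'k" where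
  "K0 l v = (\<lambda>(x, t).
     (2 powr (2 - 2 * gam l) * Gamma (2 * gam l) / (Gamma (gam l))\<^sup>2) *\<^sub>R
     (LBINT s=0..1. ((1 - s\<^sup>2) powr (gam l - 1)) *\<^sub>R v (x, phi l t * s)))"

definition K1 :: "real \<Rightarrow> ((real^'n) \<times> real \<Rightarrow> 'k::euclidean_space) \<Rightarrow> (real^'n) \<times> real \<Rightarrow> 'k" where
  "K1 l v = (\<lambda>(x, t).
     (t * 2 powr (2 * gam l) * Gamma (2 - 2 * gam l) / (Gamma (1 - gam l))\<^sup>2) *\<^sub>R
     (LBINT s=0..1. ((1 - s\<^sup>2) powr (- gam l)) *\<^sub>R v (x, phi l t * s)))"

definition a_const :: "real \<Rightarrow> real" where
  "a_const l = 2 powr (1 - 2 * gam l) * (l * Gamma (2 * gam l)) / (2 * gam l * (Gamma (gam l))\<^sup>2)"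

definition b_const :: "real \<Rightarrow> real" where
  "b_const l = (l + 2) * 2 powr (2 * gam l - 1) * Gamma (2 - 2 * gam l) / (Gamma (1 - gam l))\<^sup>2"

end

theory Submission
  imports Defs
begin

text \<open>
  Let \<open>w(s) = (1 - s\<^sup>2)\<^sup>\<beta>\<^sup>-\<^sup>1\<close> with \<open>\<beta> > 0\<close>, and let \<open>P(t) = a + b t\<close>. Both operators have the form
  \<open>u(x, t) = P(t) \<integral>\<^sub>0\<^sup>1 w(s) v(x, \<phi>(t) s) ds\<close>: for \<open>K\<^sub>0\<close> one has \<open>\<beta> = \<gamma>\<close> and constant \<open>P\<close>, for \<open>K\<^sub>1\<close>
  one has \<open>\<beta> = 1 - \<gamma>\<close> and \<open>P\<close> proportional to \<open>t\<close>. The two cases are therefore treated together.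

  Differentiate \<open>u\<close> twice in \<open>t\<close>, using \<open>\<phi>'\<^sup>2 = t\<^sup>l\<close>. The operator \<open>A\<close> acts in \<open>x\<close> and the integral in
  time, so \<open>A u\<close> is the same integral of \<open>A v = \<partial>\<^sub>t\<^sup>2v\<close>. Hence
  \<open>\<partial>\<^sub>t\<^sup>2u - t\<^sup>l A u = (2 P' \<phi>' + P \<phi>'') \<integral>\<^sub>0\<^sup>1 s w(s) \<partial>\<^sub>tv(x, \<phi> s) ds - P t\<^sup>l \<integral>\<^sub>0\<^sup>1 (1 - s\<^sup>2)\<^sup>\<beta> \<partial>\<^sub>t\<^sup>2v(x, \<phi> s) ds\<close>.
  Integration by parts (\<open>euler_weight_by_parts\<close>) turns \<open>\<phi>\<close> times the last integral into
  \<open>2 \<beta> \<integral>\<^sub>0\<^sup>1 s w(s) \<partial>\<^sub>tv(x, \<phi> s) ds - \<partial>\<^sub>tv(x, 0)\<close>. The two integrals cancel if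
  \<open>2 P' \<phi>' + P \<phi>'' = 2 \<beta> P t\<^sup>l / \<phi>\<close>, that is, if \<open>\<beta> (l + 2) = l / 2\<close> for constant \<open>P\<close> and
  \<open>\<beta> (l + 2) = l / 2 + 2\<close> for \<open>P\<close> proportional to \<open>t\<close>. These equations characterise \<open>\<gamma>\<close> and \<open>1 - \<gamma>\<close>, and
  what remains is \<open>P t\<^sup>l \<partial>\<^sub>tv(x, 0) / \<phi>\<close> (\<open>scaled_mean_equation\<close>). The numerical factors of the operators
  are the reciprocals of \<open>\<integral>\<^sub>0\<^sup>1 w\<close> (\<open>euler_weight_integral\<close>), which gives the initial values
  (\<open>scaled_mean_initial_values\<close>).

  On the analytic side, \<open>w\<close> is integrable though singular at \<open>s = 1\<close>, and the derivatives of \<open>v\<close> extend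
  continuously to \<open>t = 0\<close>, hence by Tietze's theorem to the whole space. Since \<open>s\<close> ranges over a compact
  interval, the tube lemma gives continuity of the integrals up to \<open>t = 0\<close>
  (\<open>continuous_on_weighted_integral\<close>) and differentiation under the integral sign
  (\<open>has_vector_derivative_weighted_integral\<close>).
\<close>

section \<open>Directional derivatives\<close>

lemma dir_derivI:
  assumes "((\<lambda>h. f (p + h *\<^sub>R e)) has_vector_derivative D) (at 0)"
  shows "dir_deriv e f p = D" "has_dir_deriv e f p"
  using assms vector_derivative_at[OF assms] differentiableI_vector[OF assms]
  by (simp_all add: dir_deriv_def has_dir_deriv_def)

text \<open>
  A directional derivative at a point is the derivative at \<open>0\<close> along the line through that point. On a
  line with a fixed base point \<open>p\<close> it is therefore an ordinary derivative at the parameter \<open>h\<close>, which is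
  the form that the chain rule and the mean value inequality take as input.
\<close>

lemma has_vector_derivative_along_line:
  assumes "has_dir_deriv e f (p + h *\<^sub>R e)"
  shows "((\<lambda>k. f (p + k *\<^sub>R e)) has_vector_derivative dir_deriv e f (p + h *\<^sub>R e)) (at h)"
proof -
  let ?g = "\<lambda>k. f ((p + h *\<^sub>R e) + k *\<^sub>R e)"
  have "(?g has_vector_derivative dir_deriv e f (p + h *\<^sub>R e)) (at (h - h))"
    using assms unfolding has_dir_deriv_def dir_deriv_def vector_derivative_works by simp
  moreover have "((\<lambda>k. k - h) has_vector_derivative 1) (at h)"
    by (auto intro!: derivative_eq_intros)
  ultimately have "(?g \<circ> (\<lambda>k. k - h) has_vector_derivative 1 *\<^sub>R dir_deriv e f (p + h *\<^sub>R e)) (at h)"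
    by (intro vector_diff_chain_at)
  then show ?thesis by (simp add: o_def algebra_simps)
qed

text \<open>
  Formulas for derivatives of the transforms hold only on the domain. Differentiating such a formula
  once more is legitimate because the domain is open.
\<close>

lemma dir_deriv_cong_open:
  assumes "open U" "p \<in> U" and eq: "\<And>q. q \<in> U \<Longrightarrow> f q = g q"
  shows "dir_deriv e f p = dir_deriv e g p" "has_dir_deriv e f p \<longleftrightarrow> has_dir_deriv e g p"
proof -
  have "((\<lambda>h. p + h *\<^sub>R e) \<longlongrightarrow> p + 0 *\<^sub>R e) (at 0)" by (intro tendsto_intros)
  then have "eventually (\<lambda>h. p + h *\<^sub>R e \<in> U) (at 0)"
    using assms by (auto dest: topological_tendstoD)
  then have ev: "eventually (\<lambda>h. f (p + h *\<^sub>R e) = g (p + h *\<^sub>R e)) (nhds 0)"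
    using eq \<open>p \<in> U\<close> unfolding eventually_at_filter
    by (auto elim!: eventually_mono)
  have iff: "((\<lambda>h. f (p + h *\<^sub>R e)) has_vector_derivative D) (at 0) \<longleftrightarrow>
      ((\<lambda>h. g (p + h *\<^sub>R e)) has_vector_derivative D) (at 0)" for D
    by (rule has_vector_derivative_cong_ev) (use ev eq \<open>p \<in> U\<close> in auto)
  show "dir_deriv e f p = dir_deriv e g p"
    by (simp add: dir_deriv_def vector_derivative_def iff)
  show "has_dir_deriv e f p \<longleftrightarrow> has_dir_deriv e g p"
    unfolding has_dir_deriv_def vector_derivative_works
    by (metis iff differentiableI_vector vector_derivative_works)
qed

lemma iter_deriv_simps [simp]:
  "iter_deriv [] f = f" "iter_deriv (e # es) f = dir_deriv e (iter_deriv es f)"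
  by (simp_all add: iter_deriv_def)

section \<open>Integrals against a weight on the unit interval\<close>

lemma set_integrable_weight_scaleR:
  fixes f :: "real \<Rightarrow> 'k::euclidean_space"
  assumes w: "set_integrable lborel {0<..<1} w" and f: "continuous_on {0..1} f"
  shows "set_integrable lborel {0<..<1} (\<lambda>s. w s *\<^sub>R f s)"
proof -
  have "bounded (f ` {0..1})"
    using f by (intro compact_imp_bounded compact_continuous_image) auto
  then obtain B where B: "\<And>s. s \<in> {0..1} \<Longrightarrow> norm (f s) \<le> B"
    unfolding bounded_iff by blast
  show ?thesis
  proof (rule set_integrable_bound)
    show "set_integrable lborel {0<..<1} (\<lambda>s. B * w s)"
      using w by simp
    have "continuous_on {0<..<1} f"
      by (rule continuous_on_subset[OF f]) auto
    then have "(\<lambda>s. indicator {0<..<1} s *\<^sub>R f s) \<in> borel_measurable borel"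
      by (rule borel_measurable_continuous_on_indicator[rotated]) auto
    moreover have "(\<lambda>s. indicator {0<..<1} s *\<^sub>R w s) \<in> borel_measurable borel"
      using w unfolding set_integrable_def by (auto dest: borel_measurable_integrable)
    ultimately have "(\<lambda>s. (indicator {0<..<1} s *\<^sub>R w s) *\<^sub>R (indicator {0<..<1} s *\<^sub>R f s))
        \<in> borel_measurable borel"
      by (rule borel_measurable_scaleR[rotated])
    also have "(\<lambda>s. (indicator {0<..<1} s *\<^sub>R w s) *\<^sub>R (indicator {0<..<1} s *\<^sub>R f s)) =
       (\<lambda>s. indicator {0<..<1} s *\<^sub>R (w s *\<^sub>R f s))"
      by (auto simp: fun_eq_iff indicator_def)
    finally show "set_borel_measurable lborel {0<..<1} (\<lambda>s. w s *\<^sub>R f s)"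
      by (simp add: set_borel_measurable_def)
    have "norm (w s *\<^sub>R f s) \<le> norm (B * w s)" if "s \<in> {0<..<1}" for s
    proof -
      have "norm (f s) \<le> \<bar>B\<bar>" using B[of s] that by auto
      from mult_left_mono[OF this, of "\<bar>w s\<bar>"] show ?thesis
        by (simp add: abs_mult mult.commute)
    qed
    then show "AE s in lborel. s \<in> {0<..<1} \<longrightarrow> norm (w s *\<^sub>R f s) \<le> norm (B * w s)"
      by auto
  qed
qed

lemma set_integrable_weight_mult:
  assumes "set_integrable lborel {0<..<1} w" "continuous_on {0..1} (f :: real \<Rightarrow> real)"
  shows "set_integrable lborel {0<..<1} (\<lambda>s. f s * w s)"
  using set_integrable_weight_scaleR[OF assms] by (simp add: mult.commute)

lemma norm_weighted_integral_le:
  fixes f :: "real \<Rightarrow> 'k::euclidean_space"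
  assumes w: "set_integrable lborel {0<..<1} w"
    and f: "set_integrable lborel {0<..<1} (\<lambda>s. w s *\<^sub>R f s)"
    and B: "\<And>s. 0 < s \<Longrightarrow> s < 1 \<Longrightarrow> norm (f s) \<le> B"
  shows "norm (LINT s:{0<..<1}|lborel. w s *\<^sub>R f s) \<le> B * (LINT s:{0<..<1}|lborel. \<bar>w s\<bar>)"
proof -
  have "norm (LINT s:{0<..<1}|lborel. w s *\<^sub>R f s) \<le> (LINT s:{0<..<1}|lborel. norm (w s *\<^sub>R f s))"
    by (rule set_integral_norm_bound[OF f])
  also have "\<dots> \<le> (LINT s:{0<..<1}|lborel. B * \<bar>w s\<bar>)"
  proof (rule set_integral_mono)
    show "set_integrable lborel {0<..<1} (\<lambda>s. norm (w s *\<^sub>R f s))"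
      by (rule set_integrable_norm[OF f])
    show "set_integrable lborel {0<..<1} (\<lambda>s. B * \<bar>w s\<bar>)"
      using set_integrable_abs[OF w] by simp
    show "norm (w s *\<^sub>R f s) \<le> B * \<bar>w s\<bar>" if "s \<in> {0<..<1}" for s
      using mult_left_mono[OF B[of s], of "\<bar>w s\<bar>"] that by (simp add: mult.commute)
  qed
  finally show ?thesis by simp
qed

text \<open>
  The integrand may blow up at the end of the interval through \<open>w\<close> alone: \<open>H\<close> itself is continuous up to
  both ends. By the tube lemma \<open>H p\<close> depends on \<open>p\<close> uniformly over the compact interval, and a uniform
  error is multiplied by the finite integral of \<open>\<bar>w\<bar>\<close>. The set \<open>T\<close> is arbitrary, so it may include the
  boundary \<open>t = 0\<close>.
\<close>

lemma continuous_on_weighted_integral: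
  fixes H :: "'p::topological_space \<Rightarrow> real \<Rightarrow> 'k::euclidean_space"
  assumes w: "set_integrable lborel {0<..<1} w"
    and H: "continuous_on (T \<times> {0..1}) (\<lambda>(p, s). H p s)"
  shows "continuous_on T (\<lambda>p. LINT s:{0<..<1}|lborel. w s *\<^sub>R H p s)"
proof -
  define W where "W = (LINT s:{0<..<1}|lborel. \<bar>w s\<bar>)"
  have W: "0 \<le> W"
    unfolding W_def set_lebesgue_integral_def by (intro integral_nonneg_AE) auto
  have int: "set_integrable lborel {0<..<1} (\<lambda>s. w s *\<^sub>R H p s)" if "p \<in> T" for p
  proof (rule set_integrable_weight_scaleR[OF w])
    have "continuous_on {0..1} (\<lambda>s. case (p, s) of (p, s) \<Rightarrow> H p s)"
      by (rule continuous_on_compose2[OF H]) (use that in \<open>auto intro: continuous_on_Pair continuous_on_id\<close>)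
    then show "continuous_on {0..1} (H p)" by simp
  qed
  show ?thesis
    unfolding continuous_on_def
  proof (intro ballI tendstoI)
    fix p and e :: real assume p: "p \<in> T" and e: "0 < e"
    \<comment> \<open>\<open>W\<close> vanishes for a trivial weight, hence the shift by \<open>1\<close>.\<close>
    have "0 < e / (2 * (W + 1))" using W e by simp
    then obtain X where X: "p \<in> X" "open X"
      and "\<forall>q\<in>X \<inter> T. \<forall>s\<in>{0..1}.
        dist (case (q, s) of (p, s) \<Rightarrow> H p s) (case (p, s) of (p, s) \<Rightarrow> H p s) \<le> e / (2 * (W + 1))"
      by (rule continuous_on_prod_compactE[OF H compact_Icc p])
    then have close: "\<forall>q\<in>X \<inter> T. \<forall>s\<in>{0..1}. dist (H q s) (H p s) \<le> e / (2 * (W + 1))"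
      by simp
    have "eventually (\<lambda>q. q \<in> X \<inter> T) (at p within T)"
      unfolding eventually_at_topological using X by blast
    then show "\<forall>\<^sub>F q in at p within T. dist (LINT s:{0<..<1}|lborel. w s *\<^sub>R H q s)
        (LINT s:{0<..<1}|lborel. w s *\<^sub>R H p s) < e"
    proof (rule eventually_mono)
      fix q assume q: "q \<in> X \<inter> T"
      have d: "set_integrable lborel {0<..<1} (\<lambda>s. w s *\<^sub>R (H q s - H p s))"
        using set_integral_diff(1)[OF int int, of q p] p q by (simp add: scaleR_diff_right)
      have "(LINT s:{0<..<1}|lborel. w s *\<^sub>R H q s) - (LINT s:{0<..<1}|lborel. w s *\<^sub>R H p s)
          = (LINT s:{0<..<1}|lborel. w s *\<^sub>R (H q s - H p s))"
        using set_integral_diff(2)[OF int int, of q p] p q by (simp add: scaleR_diff_right)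
      also have "norm \<dots> \<le> e / (2 * (W + 1)) * W"
        unfolding W_def[symmetric]
        by (rule norm_weighted_integral_le[OF w d, folded W_def]) (use close q in \<open>auto simp: dist_norm\<close>)
      also have "\<dots> = e * (W / (2 * (W + 1)))" by simp
      also have "\<dots> < e * 1"
        using W e by (intro mult_strict_left_mono) auto
      finally show "dist (LINT s:{0<..<1}|lborel. w s *\<^sub>R H q s)
        (LINT s:{0<..<1}|lborel. w s *\<^sub>R H p s) < e" by (simp add: dist_norm)
    qed
  qed
qed

text \<open>
  Differentiation under the integral sign. Here \<open>G\<close> is the \<open>h\<close>-derivative of \<open>F\<close> in the open interval
  only, and it is continuous up to its ends. By the mean value inequality the linearisation error of
  \<open>F\<close> at \<open>0\<close> is at most \<open>\<bar>h\<bar>\<close> times the oscillation of \<open>G\<close> near \<open>h = 0\<close>, which the tube lemma makes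
  uniformly small in \<open>s\<close>.
\<close>

lemma has_vector_derivative_weighted_integral:
  fixes F G :: "real \<Rightarrow> real \<Rightarrow> 'k::euclidean_space"
  assumes w: "set_integrable lborel {0<..<1} w" and "0 < \<delta>"
    and der: "\<And>h s. \<bar>h\<bar> < \<delta> \<Longrightarrow> 0 < s \<Longrightarrow> s < 1 \<Longrightarrow>
      ((\<lambda>h. F h s) has_vector_derivative G h s) (at h)"
    and G: "continuous_on ({-\<delta><..<\<delta>} \<times> {0..1}) (\<lambda>(h, s). G h s)"
    and int: "\<And>h. \<bar>h\<bar> < \<delta> \<Longrightarrow> set_integrable lborel {0<..<1} (\<lambda>s. w s *\<^sub>R F h s)"
  shows "((\<lambda>h. LINT s:{0<..<1}|lborel. w s *\<^sub>R F h s) has_vector_derivative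
    (LINT s:{0<..<1}|lborel. w s *\<^sub>R G 0 s)) (at 0)"
proof -
  define W where "W = (LINT s:{0<..<1}|lborel. \<bar>w s\<bar>)"
  have W: "0 \<le> W"
    unfolding W_def set_lebesgue_integral_def by (intro integral_nonneg_AE) auto
  have intG: "set_integrable lborel {0<..<1} (\<lambda>s. w s *\<^sub>R G 0 s)"
  proof (rule set_integrable_weight_scaleR[OF w])
    have "continuous_on {0..1} (\<lambda>s. case (0, s) of (h, s) \<Rightarrow> G h s)"
      by (rule continuous_on_compose2[OF G])
        (use \<open>0 < \<delta>\<close> in \<open>auto intro: continuous_on_Pair continuous_on_id\<close>)
    then show "continuous_on {0..1} (G 0)" by simp
  qed
  show ?thesis
    unfolding has_vector_derivative_def has_derivative_at_alt
  proof (intro conjI allI impI)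
    show "bounded_linear (\<lambda>h. h *\<^sub>R (LINT s:{0<..<1}|lborel. w s *\<^sub>R G 0 s))"
      by (rule bounded_linear_scaleR_left)
    fix e :: real assume e: "0 < e"
    have "0 < e / (W + 1)" using W e by simp
    from continuous_on_prod_compactE[OF G _ _ this, of 0] \<open>0 < \<delta>\<close>
    obtain X where X: "0 \<in> X" "open X"
      and close: "\<forall>h\<in>X \<inter> {-\<delta><..<\<delta>}. \<forall>s\<in>{0..1}. dist (G h s) (G 0 s) \<le> e / (W + 1)"
      by auto
    obtain d where d: "0 < d" "ball 0 d \<subseteq> X"
      using X open_contains_ball by blast
    show "\<exists>d>0. \<forall>h. norm (h - 0) < d \<longrightarrow>
      norm ((LINT s:{0<..<1}|lborel. w s *\<^sub>R F h s) - (LINT s:{0<..<1}|lborel. w s *\<^sub>R F 0 s) -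
        (h - 0) *\<^sub>R (LINT s:{0<..<1}|lborel. w s *\<^sub>R G 0 s)) \<le> e * norm (h - 0)"
    proof (intro exI conjI allI impI)
      show "0 < min d \<delta>" using d \<open>0 < \<delta>\<close> by simp
      fix h :: real assume "norm (h - 0) < min d \<delta>"
      then have h: "\<bar>h\<bar> < d" "\<bar>h\<bar> < \<delta>" by auto
      have bound: "norm (F h s - F 0 s - h *\<^sub>R G 0 s) \<le> \<bar>h\<bar> * (e / (W + 1))"
        if s: "0 < s" "s < 1" for s
      proof -
        let ?S = "{- \<bar>h\<bar> .. \<bar>h\<bar>}"
        have "norm (F h s - F 0 s - (h - 0) *\<^sub>R G 0 s) \<le> norm (h - 0) * (e / (W + 1))"
        proof (rule vector_differentiable_bound_linearization[where S = ?S
            and f = "\<lambda>h. F h s" and f' = "\<lambda>k. G k s"])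
          show "((\<lambda>h. F h s) has_vector_derivative G k s) (at k within ?S)" if "k \<in> ?S" for k
            using der[of k s] that h s by (auto intro: has_vector_derivative_at_within)
          show "closed_segment 0 h \<subseteq> ?S"
            by (auto simp: closed_segment_eq_real_ivl split: if_splits)
          show "norm (G k s - G 0 s) \<le> e / (W + 1)" if k: "k \<in> ?S" for k
          proof -
            have "k \<in> ball 0 d" using k h by auto
            then have "k \<in> X \<inter> {-\<delta><..<\<delta>}" using d k h by auto
            then show ?thesis using close s by (auto simp: dist_norm)
          qed
        qed auto
        then show ?thesis by simp
      qed
      have i1: "set_integrable lborel {0<..<1} (\<lambda>s. w s *\<^sub>R (h *\<^sub>R G 0 s))"
        using set_integrable_scaleR_right[of h, OF intG] by (simp add: mult.commute)
      have i2: "set_integrable lborel {0<..<1} (\<lambda>s. w s *\<^sub>R F h s - w s *\<^sub>R F 0 s)"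
        using int[of h] int[of 0] h \<open>0 < \<delta>\<close> by (intro set_integral_diff(1)) auto
      have d: "set_integrable lborel {0<..<1} (\<lambda>s. w s *\<^sub>R (F h s - F 0 s - h *\<^sub>R G 0 s))"
        using set_integral_diff(1)[OF i2 i1] by (simp add: scaleR_diff_right)
      have "(LINT s:{0<..<1}|lborel. w s *\<^sub>R (F h s - F 0 s - h *\<^sub>R G 0 s)) =
          (LINT s:{0<..<1}|lborel. (w s *\<^sub>R F h s - w s *\<^sub>R F 0 s) - w s *\<^sub>R (h *\<^sub>R G 0 s))"
        by (simp only: scaleR_diff_right)
      also have "\<dots> = (LINT s:{0<..<1}|lborel. w s *\<^sub>R F h s - w s *\<^sub>R F 0 s)
          - (LINT s:{0<..<1}|lborel. w s *\<^sub>R (h *\<^sub>R G 0 s))"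
        by (rule set_integral_diff(2)[OF i2 i1])
      also have "(LINT s:{0<..<1}|lborel. w s *\<^sub>R F h s - w s *\<^sub>R F 0 s) =
          (LINT s:{0<..<1}|lborel. w s *\<^sub>R F h s) - (LINT s:{0<..<1}|lborel. w s *\<^sub>R F 0 s)"
        using set_integral_diff(2)[OF int int, of h 0] h \<open>0 < \<delta>\<close> by simp
      also have "(LINT s:{0<..<1}|lborel. w s *\<^sub>R (h *\<^sub>R G 0 s)) =
          (h - 0) *\<^sub>R (LINT s:{0<..<1}|lborel. w s *\<^sub>R G 0 s)"
        by (simp only: scaleR_left_commute[of "w _" h] set_integral_scaleR_right diff_0_right)
      finally have eq: "(LINT s:{0<..<1}|lborel. w s *\<^sub>R F h s) -
          (LINT s:{0<..<1}|lborel. w s *\<^sub>R F 0 s) -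
          (h - 0) *\<^sub>R (LINT s:{0<..<1}|lborel. w s *\<^sub>R G 0 s) =
          (LINT s:{0<..<1}|lborel. w s *\<^sub>R (F h s - F 0 s - h *\<^sub>R G 0 s))" ..
      have "norm (LINT s:{0<..<1}|lborel. w s *\<^sub>R (F h s - F 0 s - h *\<^sub>R G 0 s))
          \<le> \<bar>h\<bar> * (e / (W + 1)) * W"
        by (rule norm_weighted_integral_le[OF w d, folded W_def]) (use bound in auto)
      also have "\<dots> = \<bar>h\<bar> * e * (W / (W + 1))" by simp
      also have "\<dots> \<le> \<bar>h\<bar> * e * 1"
        using W e by (intro mult_left_mono) auto
      finally show "norm ((LINT s:{0<..<1}|lborel. w s *\<^sub>R F h s) -
        (LINT s:{0<..<1}|lborel. w s *\<^sub>R F 0 s) -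
        (h - 0) *\<^sub>R (LINT s:{0<..<1}|lborel. w s *\<^sub>R G 0 s)) \<le> e * norm (h - 0)"
        unfolding eq by (simp add: mult.commute)
    qed
  qed
qed

section \<open>The time change and the domain\<close>

text \<open>
  The inverse of \<open>\<phi>\<close> on the positive half-line.
\<close>

definition psi :: "real \<Rightarrow> real \<Rightarrow> real" where
  "psi l \<tau> = ((l + 2) / 2 * \<tau>) powr (2 / (l + 2))"

lemma phi_0 [simp]: "phi l 0 = 0"
  by (simp add: phi_def)

lemma phi_pos: "0 < l \<Longrightarrow> 0 < t \<Longrightarrow> 0 < phi l t"
  by (simp add: phi_def)

lemma continuous_on_phi: "0 < l \<Longrightarrow> continuous_on {0..} (phi l)"
  unfolding phi_def by (intro continuous_on_mult_left continuous_on_powr')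
    (auto intro: continuous_on_id)

lemma has_real_derivative_phi:
  assumes "0 < l" "0 < t"
  shows "(phi l has_real_derivative t powr (l / 2)) (at t)"
proof -
  have "((\<lambda>t. 2 / (l + 2) * t powr ((l + 2) / 2)) has_real_derivative
      2 / (l + 2) * ((l + 2) / 2 * t powr ((l + 2) / 2 - 1))) (at t)"
    by (intro DERIV_cmult has_real_derivative_powr assms)
  also have "2 / (l + 2) * ((l + 2) / 2 * t powr ((l + 2) / 2 - 1)) = t powr ((l + 2) / 2 - 1)"
    using assms by simp
  also have "(l + 2) / 2 - 1 = l / 2" by (simp add: field_simps)
  finally show ?thesis by (simp add: phi_def[abs_def])
qed

lemma phi_strict_mono: "0 < l \<Longrightarrow> 0 \<le> s \<Longrightarrow> s < t \<Longrightarrow> phi l s < phi l t"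
  unfolding phi_def by (intro mult_strict_left_mono powr_less_mono2) auto

lemma psi_pos: "0 < l \<Longrightarrow> 0 < \<tau> \<Longrightarrow> 0 < psi l \<tau>"
  by (simp add: psi_def)

lemma phi_psi: "0 < l \<Longrightarrow> 0 < \<tau> \<Longrightarrow> phi l (psi l \<tau>) = \<tau>"
proof -
  assume "0 < l" "0 < \<tau>"
  then have "2 / (l + 2) * ((l + 2) / 2) = 1" by simp
  then have "psi l \<tau> powr ((l + 2) / 2) = (l + 2) / 2 * \<tau>"
    using \<open>0 < l\<close> \<open>0 < \<tau>\<close> by (simp only: psi_def powr_powr) simp
  then show ?thesis using \<open>0 < l\<close> by (simp only: phi_def) simp
qed

text \<open>
  The endpoints are excluded so that, for \<open>(x, t)\<close> in the domain, only values of \<open>f\<close> on the open set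
  \<open>\<Omega>\<^sub>\<phi>\<close> enter, and never the value at \<open>t = 0\<close>, which is known only as a limit.
\<close>

definition weighted_mean ::
    "(real \<Rightarrow> real) \<Rightarrow> real \<Rightarrow> ((real^'n) \<times> real \<Rightarrow> 'k::euclidean_space) \<Rightarrow> (real^'n) \<times> real \<Rightarrow> 'k" where
  "weighted_mean w l f p = (LINT s:{0<..<1}|lborel. w s *\<^sub>R f (fst p, phi l (snd p) * s))"

text \<open>
  A globally continuous extension in place of one to the closure: the integrals above then make sense
  for every \<open>(x, t)\<close> with \<open>t \<ge> 0\<close>, without checking that segments stay in the closure. It exists by
  Tietze's theorem.
\<close>

definition continuous_extension ::
    "'e::topological_space set \<Rightarrow> ('e \<Rightarrow> 'k::topological_space) \<Rightarrow> ('e \<Rightarrow> 'k) \<Rightarrow> bool" where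
  "continuous_extension U f g \<longleftrightarrow> continuous_on UNIV g \<and> (\<forall>p\<in>U. f p = g p)"

lemma extends_to_closureE:
  fixes f :: "'e::{metric_space, second_countable_topology} \<Rightarrow> 'k::euclidean_space"
  assumes "extends_to_closure U f"
  obtains g where "continuous_extension U f g"
proof -
  obtain g0 where g0: "continuous_on (closure U) g0" "\<forall>p\<in>U. g0 p = f p"
    using assms by (auto simp: extends_to_closure_def)
  obtain g where "continuous_on UNIV g" "\<And>p. p \<in> closure U \<Longrightarrow> g p = g0 p"
    using Tietze_unbounded[OF g0(1), of UNIV] by auto
  then have "continuous_extension U f g"
    using g0(2) closure_subset[of U] by (auto simp: continuous_extension_def)
  then show thesis by (rule that)
qed

lemma set_integrable_weighted_mean:
  fixes g :: "(real^'n) \<times> real \<Rightarrow> 'k::euclidean_space"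
  assumes "set_integrable lborel {0<..<1} w" "continuous_on UNIV g"
  shows "set_integrable lborel {0<..<1} (\<lambda>s. w s *\<^sub>R g (x, c * s))"
  by (intro set_integrable_weight_scaleR assms continuous_on_compose2[OF assms(2)] continuous_intros) auto

text \<open>
  Continuity holds up to and including \<open>t = 0\<close>. This is the source of all the initial values.
\<close>

lemma continuous_on_weighted_mean:
  fixes g :: "(real^'n) \<times> real \<Rightarrow> 'k::euclidean_space"
  assumes "0 < l" "set_integrable lborel {0<..<1} w" "continuous_on UNIV g"
  shows "continuous_on {p. 0 \<le> snd p} (weighted_mean w l g)"
proof -
  have "continuous_on ({p. 0 \<le> snd p} \<times> {0..1})
      (\<lambda>(p, s). g (fst p, phi l (snd p) * s) :: 'k)"
    unfolding case_prod_unfold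
    by (intro continuous_on_compose2[OF assms(3)] continuous_intros
        continuous_on_compose2[OF continuous_on_phi[OF assms(1)]]) auto
  from continuous_on_weighted_integral[OF assms(2) this]
  show ?thesis by (simp add: weighted_mean_def[abs_def])
qed

lemma line_in_open_set:
  fixes e :: "'e::real_normed_vector"
  assumes "open U" "p \<in> U"
  obtains \<delta> where "0 < \<delta>" "\<And>h. \<bar>h\<bar> < \<delta> \<Longrightarrow> p + h *\<^sub>R e \<in> U"
proof -
  have "((\<lambda>h. p + h *\<^sub>R e) \<longlongrightarrow> p + 0 *\<^sub>R e) (at 0)" by (intro tendsto_intros)
  then have "eventually (\<lambda>h. p + h *\<^sub>R e \<in> U) (at 0)"
    using assms by (auto dest: topological_tendstoD)
  then obtain \<delta> where "0 < \<delta>" "\<And>h. h \<noteq> 0 \<Longrightarrow> \<bar>h\<bar> < \<delta> \<Longrightarrow> p + h *\<^sub>R e \<in> U"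
    by (auto simp: eventually_at)
  then show thesis
    using assms(2) by (intro that[of \<delta>]) (metis add.right_neutral scaleR_zero_left)+
qed

locale backward_domain =
  fixes l :: real and \<Omega> :: "((real^'n) \<times> real) set"
  assumes l_pos: "0 < l" and open_domain: "open \<Omega>" and upper: "\<Omega> \<subseteq> upper_half_space"
    and backward: "backward_time_connected \<Omega>"
begin

abbreviation "U \<equiv> phi_image l \<Omega>"

lemma time_pos: "p \<in> \<Omega> \<Longrightarrow> 0 < snd p"
  using upper by (auto simp: upper_half_space_def)

lemma mem_phi_image: "p \<in> \<Omega> \<Longrightarrow> 0 < s \<Longrightarrow> s \<le> 1 \<Longrightarrow> (fst p, phi l (snd p) * s) \<in> U"
  using phi_pos[OF l_pos time_pos, of p]
  by (auto simp: phi_image_def mult_left_le intro!: bexI[of _ p] exI)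

text \<open>
  Backward connectedness makes the \<open>\<phi>\<close>-image the exact preimage of the domain under \<open>(x, \<tau>) \<mapsto> (x, \<psi>(\<tau>))\<close>,
  since every point below \<open>\<phi>(t)\<close> comes from a point of the domain below \<open>t\<close>. In particular the image is
  open.
\<close>

lemma phi_image_eq: "U = {p. 0 < snd p} \<inter> (\<lambda>p. (fst p, psi l (snd p))) -` \<Omega>"
proof (intro equalityI subsetI)
  fix p assume "p \<in> U"
  then obtain x t \<tau> where p: "p = (x, \<tau>)" "(x, t) \<in> \<Omega>" "0 < \<tau>" "\<tau> \<le> phi l t"
    by (auto simp: phi_image_def)
  have "psi l \<tau> \<le> t"
  proof (rule ccontr)
    assume "\<not> psi l \<tau> \<le> t"
    then have "phi l t < phi l (psi l \<tau>)"
      using phi_strict_mono[OF l_pos, of t "psi l \<tau>"] time_pos[OF p(2)] by simp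
    then show False using p phi_psi[OF l_pos] by simp
  qed
  then have "(x, psi l \<tau>) \<in> \<Omega>"
    using backward p(2) psi_pos[OF l_pos p(3)] by (auto simp: backward_time_connected_def)
  then show "p \<in> {p. 0 < snd p} \<inter> (\<lambda>p. (fst p, psi l (snd p))) -` \<Omega>"
    using p by simp
next
  fix p assume p: "p \<in> {p. 0 < snd p} \<inter> (\<lambda>p. (fst p, psi l (snd p))) -` \<Omega>"
  then have "(fst (fst p, psi l (snd p)), phi l (snd (fst p, psi l (snd p))) * 1) \<in> U"
    by (intro mem_phi_image) auto
  then show "p \<in> U" using p phi_psi[OF l_pos, of "snd p"] by simp
qed

lemma open_phi_image: "open U"
  unfolding phi_image_eq
proof (rule continuous_open_preimage)
  show "continuous_on {p. 0 < snd p} (\<lambda>p :: (real^'n) \<times> real. (fst p, psi l (snd p)))"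
    unfolding psi_def using l_pos by (intro continuous_intros) auto
  show "open {p :: (real^'n) \<times> real. 0 < snd p}"
    by (intro open_Collect_less continuous_intros)
qed (rule open_domain)

lemma weighted_mean_cong:
  assumes "p \<in> \<Omega>" "\<And>q. q \<in> U \<Longrightarrow> f q = g q"
  shows "weighted_mean w l f p = weighted_mean w l g p"
  unfolding weighted_mean_def
  by (rule set_lebesgue_integral_cong) (use assms mem_phi_image[OF assms(1)] in auto)

lemma set_integrable_weighted_mean_extension:
  fixes f :: "(real^'n) \<times> real \<Rightarrow> 'k::euclidean_space"
  assumes w: "set_integrable lborel {0<..<1} w"
    and g: "continuous_extension U f g" and p: "p \<in> \<Omega>"
  shows "set_integrable lborel {0<..<1} (\<lambda>s. w s *\<^sub>R f (fst p, phi l (snd p) * s))"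
proof -
  have "set_integrable lborel {0<..<1} (\<lambda>s. w s *\<^sub>R g (fst p, phi l (snd p) * s))"
    using g by (intro set_integrable_weighted_mean w) (auto simp: continuous_extension_def)
  also have "?this \<longleftrightarrow> ?thesis"
    using g mem_phi_image[OF p] by (intro set_integrable_cong) (auto simp: continuous_extension_def)
  finally show ?thesis .
qed

lemma continuous_on_weighted_mean_domain:
  fixes f :: "(real^'n) \<times> real \<Rightarrow> 'k::euclidean_space"
  assumes w: "set_integrable lborel {0<..<1} w" and g: "continuous_extension U f g"
  shows "continuous_on \<Omega> (weighted_mean w l f)"
proof -
  have "continuous_on \<Omega> (weighted_mean w l g)"
    by (rule continuous_on_subset[OF continuous_on_weighted_mean[OF l_pos w]])
      (use g time_pos in \<open>auto simp: continuous_extension_def less_imp_le\<close>)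
  also have "?this \<longleftrightarrow> ?thesis"
    by (intro continuous_on_cong refl weighted_mean_cong) (use g in \<open>auto simp: continuous_extension_def\<close>)
  finally show ?thesis .
qed

lemma weighted_mean_has_derivative_x:
  fixes f :: "(real^'n) \<times> real \<Rightarrow> 'k::euclidean_space"
  assumes w: "set_integrable lborel {0<..<1} w"
    and g: "continuous_extension U f g"
    and g': "continuous_extension U (dir_deriv (ex i) f) g'"
    and diff: "\<And>q. q \<in> U \<Longrightarrow> has_dir_deriv (ex i) f q" and p: "p \<in> \<Omega>"
  shows "((\<lambda>h. weighted_mean w l f (p + h *\<^sub>R ex i)) has_vector_derivative
    weighted_mean w l (dir_deriv (ex i) f) p) (at 0)"
proof -
  obtain \<delta> where \<delta>: "0 < \<delta>" and line: "\<And>h. \<bar>h\<bar> < \<delta> \<Longrightarrow> p + h *\<^sub>R ex i \<in> \<Omega>"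
    using line_in_open_set[OF open_domain p] by blast
  have g'_cont: "continuous_on UNIV g'" and g'_eq: "\<And>q. q \<in> U \<Longrightarrow> dir_deriv (ex i) f q = g' q"
    using g' by (auto simp: continuous_extension_def)
  have cong: "weighted_mean u l (dir_deriv (ex i) f) p = weighted_mean u l g' p" for u
    by (rule weighted_mean_cong[OF p]) (rule g'_eq)
  define F where "F = (\<lambda>h s. f (fst (p + h *\<^sub>R ex i), phi l (snd (p + h *\<^sub>R ex i)) * s))"
  define G where "G = (\<lambda>h s. g' (fst (p + h *\<^sub>R ex i), phi l (snd (p + h *\<^sub>R ex i)) * s))"
  have "((\<lambda>h. LINT s:{0<..<1}|lborel. w s *\<^sub>R F h s) has_vector_derivative
      (LINT s:{0<..<1}|lborel. w s *\<^sub>R G 0 s)) (at 0)"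
  proof (rule has_vector_derivative_weighted_integral[OF w \<delta>])
    fix h s :: real assume h: "\<bar>h\<bar> < \<delta>" and s: "0 < s" "s < 1"
    define q where "q = (fst p, phi l (snd p) * s)"
    have eq: "(fst (p + h *\<^sub>R ex i), phi l (snd (p + h *\<^sub>R ex i)) * s) = q + h *\<^sub>R ex i" for h
      by (simp add: q_def ex_def)
    have "q + h *\<^sub>R ex i \<in> U"
      using mem_phi_image[OF line[OF h], of s] s unfolding eq by simp
    with has_vector_derivative_along_line[OF diff, of q h] g'_eq
    show "((\<lambda>h. F h s) has_vector_derivative G h s) (at h)"
      unfolding F_def G_def eq by simp
  next
    show "continuous_on ({- \<delta><..<\<delta>} \<times> {0..1}) (\<lambda>(h, s). G h s)"
      unfolding G_def case_prod_unfold ex_def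
      by (intro continuous_on_compose2[OF g'_cont]) (auto intro!: continuous_intros)
  next
    fix h :: real assume "\<bar>h\<bar> < \<delta>"
    then show "set_integrable lborel {0<..<1} (\<lambda>s. w s *\<^sub>R F h s)"
      unfolding F_def by (intro set_integrable_weighted_mean_extension[OF w g] line)
  qed
  moreover have "(LINT s:{0<..<1}|lborel. w s *\<^sub>R G 0 s) = weighted_mean w l (dir_deriv (ex i) f) p"
    unfolding cong by (simp add: weighted_mean_def G_def ex_def)
  ultimately show ?thesis by (simp add: weighted_mean_def F_def)
qed

text \<open>
  The chain rule produces \<open>\<phi>'(t) s = t\<^sup>l\<^sup>/\<^sup>2 s\<close>; the factor \<open>s\<close> is absorbed into the weight, so that the
  derivative is again a weighted mean and the rule can be iterated.
\<close>

lemma weighted_mean_has_derivative_t: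
  fixes f :: "(real^'n) \<times> real \<Rightarrow> 'k::euclidean_space"
  assumes w: "set_integrable lborel {0<..<1} w"
    and g: "continuous_extension U f g"
    and g': "continuous_extension U (partial_t f) g'"
    and diff: "\<And>q. q \<in> U \<Longrightarrow> has_dir_deriv et f q" and p: "p \<in> \<Omega>"
  shows "((\<lambda>h. weighted_mean w l f (p + h *\<^sub>R et)) has_vector_derivative
    snd p powr (l / 2) *\<^sub>R weighted_mean (\<lambda>s. s * w s) l (partial_t f) p) (at 0)"
proof -
  obtain \<delta> where \<delta>: "0 < \<delta>" and line: "\<And>h. \<bar>h\<bar> < \<delta> \<Longrightarrow> p + h *\<^sub>R et \<in> \<Omega>"
    using line_in_open_set[OF open_domain p] by blast
  have pos: "0 < snd p + h" if "\<bar>h\<bar> < \<delta>" for h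
    using time_pos[OF line[OF that]] by (simp add: et_def)
  have g'_cont: "continuous_on UNIV g'" and g'_eq: "\<And>q. q \<in> U \<Longrightarrow> partial_t f q = g' q"
    using g' by (auto simp: continuous_extension_def)
  have cong: "weighted_mean u l (partial_t f) p = weighted_mean u l g' p" for u
    by (rule weighted_mean_cong[OF p]) (rule g'_eq)
  define F where "F = (\<lambda>h s. f (fst (p + h *\<^sub>R et), phi l (snd (p + h *\<^sub>R et)) * s))"
  define G where "G = (\<lambda>h s. ((snd p + h) powr (l / 2) * s) *\<^sub>R
    g' (fst p, phi l (snd p + h) * s))"
  have "((\<lambda>h. LINT s:{0<..<1}|lborel. w s *\<^sub>R F h s) has_vector_derivative
      (LINT s:{0<..<1}|lborel. w s *\<^sub>R G 0 s)) (at 0)"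
  proof (rule has_vector_derivative_weighted_integral[OF w \<delta>])
    fix h s :: real assume h: "\<bar>h\<bar> < \<delta>" and s: "0 < s" "s < 1"
    let ?c = "\<lambda>h. phi l (snd p + h) * s"
    let ?L = "\<lambda>k. f ((fst p, 0) + k *\<^sub>R et)"
    have "(fst p, 0) + ?c h *\<^sub>R et \<in> U"
      using mem_phi_image[OF line[OF h], of s] s by (simp add: et_def)
    then have "(?L has_vector_derivative g' (fst p, ?c h)) (at (?c h))"
      using has_vector_derivative_along_line[OF diff, of "(fst p, 0)" "?c h"] g'_eq
      by (simp add: et_def)
    moreover have "(phi l has_real_derivative (snd p + h) powr (l / 2)) (at (snd p + h))"
      by (rule has_real_derivative_phi[OF l_pos pos[OF h]])
    then have "((\<lambda>h. phi l (snd p + h)) has_real_derivative (snd p + h) powr (l / 2)) (at h)"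
      by (subst (asm) add.commute, subst (asm) DERIV_shift) (simp add: add.commute)
    then have "(?c has_real_derivative (snd p + h) powr (l / 2) * s) (at h)"
      by (rule DERIV_cmult_right)
    then have "(?c has_vector_derivative (snd p + h) powr (l / 2) * s) (at h)"
      by (simp add: has_real_derivative_iff_has_vector_derivative)
    ultimately have "(?L \<circ> ?c has_vector_derivative
        ((snd p + h) powr (l / 2) * s) *\<^sub>R g' (fst p, ?c h)) (at h)"
      by (intro vector_diff_chain_at)
    then show "((\<lambda>h. F h s) has_vector_derivative G h s) (at h)"
      by (simp add: F_def G_def et_def o_def)
  next
    have pos': "snd p + fst z \<noteq> 0" "0 \<le> snd p + fst z"
      if "z \<in> {- \<delta><..<\<delta>} \<times> {0..1}" for z :: "real \<times> real"
      using pos[of "fst z"] that by (auto simp: abs_less_iff)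
    show "continuous_on ({- \<delta><..<\<delta>} \<times> {0..1}) (\<lambda>(h, s). G h s)"
      unfolding G_def case_prod_unfold
      by (intro continuous_intros continuous_on_compose2[OF g'_cont]
          continuous_on_compose2[OF continuous_on_phi[OF l_pos]] ballI)
        (use pos' in \<open>auto simp del: greaterThanLessThan_iff\<close>)
  next
    fix h :: real assume "\<bar>h\<bar> < \<delta>"
    then show "set_integrable lborel {0<..<1} (\<lambda>s. w s *\<^sub>R F h s)"
      unfolding F_def by (intro set_integrable_weighted_mean_extension[OF w g] line)
  qed
  moreover have "(LINT s:{0<..<1}|lborel. w s *\<^sub>R G 0 s) =
      snd p powr (l / 2) *\<^sub>R weighted_mean (\<lambda>s. s * w s) l (partial_t f) p"
    unfolding cong unfolding weighted_mean_def G_def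
    by (subst set_integral_scaleR_right[symmetric]) (simp add: mult_ac)
  ultimately show ?thesis by (simp add: weighted_mean_def F_def)
qed

end

section \<open>The weight \<open>(1 - s\<^sup>2)\<^sup>\<beta>\<^sup>-\<^sup>1\<close>\<close>

definition euler_weight :: "real \<Rightarrow> real \<Rightarrow> real" where
  "euler_weight \<beta> s = (1 - s\<^sup>2) powr (\<beta> - 1)"

text \<open>
  Substituting \<open>(1 + s) / 2\<close> in the integral of \<open>t\<^sup>\<beta>\<^sup>-\<^sup>1 (1 - t)\<^sup>\<beta>\<^sup>-\<^sup>1\<close> gives the integral of the weight over
  \<open>[-1, 1]\<close> as a multiple of \<open>B(\<beta>, \<beta>)\<close>, and the weight is even. Going through \<open>B(\<beta>, \<beta>)\<close> instead of
  \<open>B(1/2, \<beta>)\<close> yields the normalising constants of the operators in the form in which they are given,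
  without the duplication formula.
\<close>

lemma euler_weight_has_integral:
  assumes "0 < \<beta>"
  shows "(euler_weight \<beta> has_integral 2 powr (2 * \<beta> - 2) * (Gamma \<beta>)\<^sup>2 / Gamma (2 * \<beta>)) {0..1}"
proof -
  let ?w = "euler_weight \<beta>"
  have "((\<lambda>t. t powr (\<beta> - 1) * (1 - t) powr (\<beta> - 1)) has_integral Beta \<beta> \<beta>) (cbox 0 (1::real))"
    using has_integral_Beta_real[of \<beta> \<beta>] assms by simp
  from has_integral_affinity'[OF this, of "1/2" "1/2"]
  have "((\<lambda>s. (s / 2 + 1 / 2) powr (\<beta> - 1) * (1 - (s / 2 + 1 / 2)) powr (\<beta> - 1))
      has_integral 2 * Beta \<beta> \<beta>) {-1..1}"
    by (simp add: field_simps)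
  then have "((\<lambda>s. 4 powr (\<beta> - 1) * ((s / 2 + 1 / 2) powr (\<beta> - 1) * (1 - (s / 2 + 1 / 2)) powr (\<beta> - 1)))
      has_integral 4 powr (\<beta> - 1) * (2 * Beta \<beta> \<beta>)) {-1..1}"
    by (rule has_integral_mult_right)
  moreover have "4 powr (\<beta> - 1) * ((s / 2 + 1 / 2) powr (\<beta> - 1) * (1 - (s / 2 + 1 / 2)) powr (\<beta> - 1))
      = ?w s" if "s \<in> {-1..1}" for s :: real
  proof -
    have "1 - s\<^sup>2 = 4 * ((s / 2 + 1 / 2) * (1 - (s / 2 + 1 / 2)))"
      by (simp add: field_simps power2_eq_square)
    then show ?thesis
      unfolding euler_weight_def using that by (simp only: powr_mult)
  qed
  ultimately have total: "(?w has_integral 4 powr (\<beta> - 1) * (2 * Beta \<beta> \<beta>)) {-1..1}"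
    by (rule has_integral_eq[rotated])
  have "?w integrable_on {0..1}"
    by (rule integrable_on_subinterval[where S = "{-1..1}"]) (use total in auto)
  then obtain I where I: "(?w has_integral I) {0..1}" by blast
  have "((\<lambda>s. ?w (- s)) has_integral I) {-1..-0}"
    using I by (subst has_integral_reflect_real) auto
  then have "(?w has_integral I) {-1..0}" by (simp add: euler_weight_def[abs_def])
  from has_integral_combine[OF _ _ this I] have "(?w has_integral I + I) {-1..1}" by simp
  then have "I + I = 4 powr (\<beta> - 1) * (2 * Beta \<beta> \<beta>)"
    using total by (rule has_integral_unique)
  then have "I = 4 powr (\<beta> - 1) * Beta \<beta> \<beta>" by simp
  moreover have "Beta \<beta> \<beta> = (Gamma \<beta>)\<^sup>2 / Gamma (2 * \<beta>)"
    by (simp add: Beta_def power2_eq_square rGamma_inverse_Gamma divide_inverse)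
  moreover have "(4::real) powr (\<beta> - 1) = 2 powr (2 * \<beta> - 2)"
  proof -
    have "(4::real) = 2 powr 2" by simp
    then have "(4::real) powr (\<beta> - 1) = 2 powr (2 * (\<beta> - 1))" by (simp only: powr_powr)
    then show ?thesis by (simp add: algebra_simps)
  qed
  ultimately have "I = 2 powr (2 * \<beta> - 2) * (Gamma \<beta>)\<^sup>2 / Gamma (2 * \<beta>)" by simp
  with I show ?thesis by simp
qed

lemma euler_weight_integral:
  assumes "0 < \<beta>"
  shows "set_integrable lborel {0<..<1} (euler_weight \<beta>)"
    and "(LINT s:{0<..<1}|lborel. euler_weight \<beta> s) =
      2 powr (2 * \<beta> - 2) * (Gamma \<beta>)\<^sup>2 / Gamma (2 * \<beta>)"
proof -
  have I: "(euler_weight \<beta> has_integral 2 powr (2 * \<beta> - 2) * (Gamma \<beta>)\<^sup>2 / Gamma (2 * \<beta>)) {0<..<1}"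
    using euler_weight_has_integral[OF assms] by (simp add: has_integral_Icc_iff_Ioo)
  have "euler_weight \<beta> absolutely_integrable_on {0<..<1}"
    using I by (intro nonnegative_absolutely_integrable_1) (auto simp: euler_weight_def)
  moreover have "(\<lambda>s. indicator {0<..<1} s *\<^sub>R euler_weight \<beta> s) \<in> borel_measurable borel"
    unfolding euler_weight_def by measurable
  ultimately show int: "set_integrable lborel {0<..<1} (euler_weight \<beta>)"
    unfolding set_integrable_def by (simp add: integrable_completion)
  show "(LINT s:{0<..<1}|lborel. euler_weight \<beta> s) =
      2 powr (2 * \<beta> - 2) * (Gamma \<beta>)\<^sup>2 / Gamma (2 * \<beta>)"
    using set_borel_integral_eq_integral(2)[OF int] I by (simp add: integral_unique)
qed

text \<open>
  Integration by parts with the primitive \<open>(1 - s\<^sup>2)\<^sup>\<beta> Y(c s)\<close>. At \<open>s = 1\<close> the power vanishes since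
  \<open>\<beta> > 0\<close>, so the only boundary term is \<open>Y 0\<close>: this is where the initial velocity enters the right-hand
  side of the transformed equation.
\<close>

lemma euler_weight_by_parts:
  fixes Y Y' :: "real \<Rightarrow> 'k::euclidean_space"
  assumes "0 < \<beta>" "0 < c" and Y: "continuous_on {0..c} Y" and Y': "continuous_on {0..c} Y'"
    and der: "\<And>\<tau>. 0 < \<tau> \<Longrightarrow> \<tau> < c \<Longrightarrow> (Y has_vector_derivative Y' \<tau>) (at \<tau>)"
  shows "c *\<^sub>R (LINT s:{0<..<1}|lborel. ((1 - s\<^sup>2) * euler_weight \<beta> s) *\<^sub>R Y' (c * s)) =
    (2 * \<beta>) *\<^sub>R (LINT s:{0<..<1}|lborel. (s * euler_weight \<beta> s) *\<^sub>R Y (c * s)) - Y 0"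
proof -
  note w = euler_weight_integral(1)[OF \<open>0 < \<beta>\<close>]
  have maps: "c * s \<in> {0..c}" if "s \<in> {0..1}" for s
    using that \<open>0 < c\<close> by (auto intro: mult_left_le)
  have Yc: "continuous_on {0..1} (\<lambda>s. Y (c * s))" "continuous_on {0..1} (\<lambda>s. Y' (c * s))"
    by (intro continuous_on_compose2[OF Y] continuous_on_compose2[OF Y'] continuous_intros; use maps in auto)+
  define F where "F = (\<lambda>s. (1 - s\<^sup>2) powr \<beta> *\<^sub>R Y (c * s))"
  define F1 where "F1 = (\<lambda>s. (s * euler_weight \<beta> s) *\<^sub>R Y (c * s))"
  define F2 where "F2 = (\<lambda>s. ((1 - s\<^sup>2) * euler_weight \<beta> s) *\<^sub>R Y' (c * s))"
  have F1: "set_integrable lborel {0<..<1} F1"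
    unfolding F1_def
    by (intro set_integrable_weight_scaleR set_integrable_weight_mult w Yc continuous_intros)
  have F2: "set_integrable lborel {0<..<1} F2"
    unfolding F2_def
    by (intro set_integrable_weight_scaleR set_integrable_weight_mult w Yc continuous_intros)
  have s2: "s\<^sup>2 < 1" if "0 < s" "s < 1" for s :: real
    using that by (simp add: power_less_one_iff)
  have "(LBINT s=0..1. c *\<^sub>R F2 s - (2 * \<beta>) *\<^sub>R F1 s) = F 1 - F 0"
  proof (rule interval_integral_FTC_integrable)
    show "(F has_vector_derivative c *\<^sub>R F2 s - (2 * \<beta>) *\<^sub>R F1 s) (at s)"
      if "0 < ereal s" "ereal s < 1" for s
    proof -
      have s: "0 < s" "s < 1" using that by auto
      have "((\<lambda>s. (1 - s\<^sup>2) powr \<beta>) has_real_derivative \<beta> * (1 - s\<^sup>2) powr (\<beta> - 1) * (- 2 * s)) (at s)"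
        using s2[OF s] by (auto intro!: derivative_eq_intros)
      moreover have "(Y has_vector_derivative Y' (c * s)) (at (c * s))"
        using der[of "c * s"] s \<open>0 < c\<close> by simp
      then have "(Y \<circ> (\<lambda>s. c * s) has_vector_derivative c *\<^sub>R Y' (c * s)) (at s)"
        by (intro vector_diff_chain_at) (auto intro!: derivative_eq_intros)
      then have "((\<lambda>s. Y (c * s)) has_vector_derivative c *\<^sub>R Y' (c * s)) (at s)" by (simp add: o_def)
      ultimately have "(F has_vector_derivative (1 - s\<^sup>2) powr \<beta> *\<^sub>R (c *\<^sub>R Y' (c * s)) +
          (\<beta> * (1 - s\<^sup>2) powr (\<beta> - 1) * (- 2 * s)) *\<^sub>R Y (c * s)) (at s)"
        unfolding F_def by (rule has_vector_derivative_scaleR)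
      also have "(1 - s\<^sup>2) powr \<beta> = (1 - s\<^sup>2) * euler_weight \<beta> s"
        using s2[OF s] by (simp add: euler_weight_def powr_mult_base)
      finally show ?thesis by (simp add: F1_def F2_def euler_weight_def algebra_simps)
    qed
    show "isCont (\<lambda>s. c *\<^sub>R F2 s - (2 * \<beta>) *\<^sub>R F1 s) s" if "0 < ereal s" "ereal s < 1" for s
    proof -
      have s: "s \<in> {0<..<1}" using that by auto
      have "continuous_on {0<..<1} (\<lambda>s. c *\<^sub>R F2 s - (2 * \<beta>) *\<^sub>R F1 s)"
        unfolding F1_def F2_def euler_weight_def
        by (intro continuous_intros continuous_on_subset[OF Yc(1)] continuous_on_subset[OF Yc(2)])
          (auto dest!: s2)
      then show ?thesis using s by (simp add: continuous_on_eq_continuous_at)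
    qed
    show "set_integrable lborel (einterval 0 1) (\<lambda>s. c *\<^sub>R F2 s - (2 * \<beta>) *\<^sub>R F1 s)"
      using F1 F2 by (simp add: zero_ereal_def one_ereal_def)
    have F: "continuous_on {0..1} F"
      unfolding F_def
      by (intro continuous_on_scaleR Yc(1) continuous_on_powr' continuous_intros)
        (use \<open>0 < \<beta>\<close> in \<open>auto simp: abs_square_le_1\<close>)
    have "(F \<longlongrightarrow> F 0) (at_right 0)"
      using F by (rule continuous_on_Icc_at_rightD) simp
    then show "((F \<circ> real_of_ereal) \<longlongrightarrow> F 0) (at_right 0)"
      by (simp add: zero_ereal_def ereal_tendsto_simps)
    have "(F \<longlongrightarrow> F 1) (at_left 1)"
      using F by (rule continuous_on_Icc_at_leftD) simp
    then show "((F \<circ> real_of_ereal) \<longlongrightarrow> F 1) (at_left 1)"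
      by (simp add: one_ereal_def ereal_tendsto_simps)
  qed simp
  also have "F 1 - F 0 = - Y 0" by (simp add: F_def)
  also have "(LBINT s=0..1. c *\<^sub>R F2 s - (2 * \<beta>) *\<^sub>R F1 s) =
      (LINT s:{0<..<1}|lborel. c *\<^sub>R F2 s - (2 * \<beta>) *\<^sub>R F1 s)"
    by (simp add: interval_lebesgue_integral_def zero_ereal_def one_ereal_def)
  also have "\<dots> = c *\<^sub>R (LINT s:{0<..<1}|lborel. F2 s) - (2 * \<beta>) *\<^sub>R (LINT s:{0<..<1}|lborel. F1 s)"
    using F1 F2 by (subst set_integral_diff(2)) auto
  finally show ?thesis by (simp add: F1_def F2_def algebra_simps)
qed

section \<open>The transformed function\<close>

text \<open>
  Both operators have this form: \<open>b = 0\<close> for \<open>K\<^sub>0\<close> and \<open>a = 0\<close> for \<open>K\<^sub>1\<close>.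
\<close>

definition scaled_mean ::
    "real \<Rightarrow> real \<Rightarrow> (real \<Rightarrow> real) \<Rightarrow> real \<Rightarrow> ((real^'n) \<times> real \<Rightarrow> 'k::euclidean_space) \<Rightarrow>
     (real^'n) \<times> real \<Rightarrow> 'k" where
  "scaled_mean a b w l f p = (a + b * snd p) *\<^sub>R weighted_mean w l f p"

context backward_domain
begin

lemma scaled_mean_dir_deriv_x:
  fixes f :: "(real^'n) \<times> real \<Rightarrow> 'k::euclidean_space"
  assumes "set_integrable lborel {0<..<1} w"
    and "extends_to_closure U f" "extends_to_closure U (dir_deriv (ex i) f)"
    and "\<And>q. q \<in> U \<Longrightarrow> has_dir_deriv (ex i) f q" and "p \<in> \<Omega>"
  shows "dir_deriv (ex i) (scaled_mean a b w l f) p = scaled_mean a b w l (dir_deriv (ex i) f) p"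
    and "has_dir_deriv (ex i) (scaled_mean a b w l f) p"
proof -
  obtain g g' where "continuous_extension U f g" "continuous_extension U (dir_deriv (ex i) f) g'"
    using assms extends_to_closureE by metis
  then have "((\<lambda>h. weighted_mean w l f (p + h *\<^sub>R ex i)) has_vector_derivative
      weighted_mean w l (dir_deriv (ex i) f) p) (at 0)"
    using assms by (intro weighted_mean_has_derivative_x)
  then have "((\<lambda>h. (a + b * snd p) *\<^sub>R weighted_mean w l f (p + h *\<^sub>R ex i)) has_vector_derivative
      (a + b * snd p) *\<^sub>R weighted_mean w l (dir_deriv (ex i) f) p) (at 0)"
    by (rule bounded_linear.has_vector_derivative[OF bounded_linear_scaleR_right])
  then have "((\<lambda>h. scaled_mean a b w l f (p + h *\<^sub>R ex i)) has_vector_derivative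
      scaled_mean a b w l (dir_deriv (ex i) f) p) (at 0)"
    by (simp add: scaled_mean_def ex_def)
  from dir_derivI[OF this]
  show "dir_deriv (ex i) (scaled_mean a b w l f) p = scaled_mean a b w l (dir_deriv (ex i) f) p"
    and "has_dir_deriv (ex i) (scaled_mean a b w l f) p" .
qed

text \<open>
  The integration acts in time only, so the transform commutes with all \<open>x\<close>-derivatives of \<open>v\<close> that
  extend continuously to the closure.
\<close>

lemma iter_deriv_scaled_mean_x:
  fixes v :: "(real^'n) \<times> real \<Rightarrow> 'k::euclidean_space"
  assumes w: "set_integrable lborel {0<..<1} w" and v: "Cm2_closure m U v"
    and "es \<in> lists (range ex)" "length es \<le> m" "p \<in> \<Omega>"
  shows "iter_deriv es (scaled_mean a b w l v) p = scaled_mean a b w l (iter_deriv es v) p"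
  using assms(3-5)
proof (induction es arbitrary: p rule: lists.induct)
  case Nil
  then show ?case by simp
next
  case (Cons e es)
  then obtain i where e: "e = ex i" by auto
  have "dir_deriv e (iter_deriv es (scaled_mean a b w l v)) p =
      dir_deriv e (scaled_mean a b w l (iter_deriv es v)) p"
    by (rule dir_deriv_cong_open[OF open_domain Cons.prems(2)]) (use Cons in auto)
  also have "\<dots> = scaled_mean a b w l (dir_deriv e (iter_deriv es v)) p"
    unfolding e
  proof (rule scaled_mean_dir_deriv_x(1)[OF w _ _ _ Cons.prems(2)])
    show "extends_to_closure U (iter_deriv es v)"
      using v Cons by (auto simp: Cm2_closure_def)
    have "extends_to_closure U (iter_deriv (e # es) v)"
      using v Cons lists.Cons[OF Cons.hyps(1,2)] unfolding Cm2_closure_def by blast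
    then show "extends_to_closure U (dir_deriv (ex i) (iter_deriv es v))" by (simp add: e)
    show "has_dir_deriv (ex i) (iter_deriv es v) q" if "q \<in> U" for q
      using v Cons that by (auto simp: Cm2_closure_def Cm2_def Ck_along_def)
  qed
  finally show ?case by simp
qed

lemma continuous_on_scaled_mean:
  fixes f :: "(real^'n) \<times> real \<Rightarrow> 'k::euclidean_space"
  assumes "set_integrable lborel {0<..<1} w" "extends_to_closure U f"
  shows "continuous_on \<Omega> (scaled_mean a b w l f)"
proof -
  obtain g where "continuous_extension U f g" using assms(2) by (rule extends_to_closureE)
  from continuous_on_weighted_mean_domain[OF assms(1) this] show ?thesis
    unfolding scaled_mean_def[abs_def] by (intro continuous_intros)
qed

lemma Ck_along_x_scaled_mean:
  fixes v :: "(real^'n) \<times> real \<Rightarrow> 'k::euclidean_space"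
  assumes w: "set_integrable lborel {0<..<1} w" and v: "Cm2_closure m U v"
  shows "Ck_along (range ex) m \<Omega> (scaled_mean a b w l v)"
  unfolding Ck_along_def
proof (intro conjI ballI impI)
  fix es :: "((real^'n) \<times> real) list" assume es: "es \<in> lists (range ex)"
  {
    assume "length es \<le> m"
    then have "continuous_on \<Omega> (scaled_mean a b w l (iter_deriv es v))"
      using v es by (intro continuous_on_scaled_mean[OF w]) (auto simp: Cm2_closure_def)
    also have "?this \<longleftrightarrow> continuous_on \<Omega> (iter_deriv es (scaled_mean a b w l v))"
      using \<open>length es \<le> m\<close>
      by (intro continuous_on_cong refl) (auto simp: iter_deriv_scaled_mean_x[OF w v es])
    finally show "continuous_on \<Omega> (iter_deriv es (scaled_mean a b w l v))" .
  next
    fix e :: "(real^'n) \<times> real" and p assume len: "length es < m" and "e \<in> range ex" and p: "p \<in> \<Omega>"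
    then obtain i where e: "e = ex i" by auto
    have "has_dir_deriv e (iter_deriv es (scaled_mean a b w l v)) p \<longleftrightarrow>
        has_dir_deriv e (scaled_mean a b w l (iter_deriv es v)) p"
      using len by (intro dir_deriv_cong_open(2)[OF open_domain p] iter_deriv_scaled_mean_x[OF w v es]) auto
    moreover have "has_dir_deriv e (scaled_mean a b w l (iter_deriv es v)) p"
      unfolding e
    proof (rule scaled_mean_dir_deriv_x(2)[OF w _ _ _ p])
      show "extends_to_closure U (iter_deriv es v)"
        using v es len by (auto simp: Cm2_closure_def)
      have "extends_to_closure U (iter_deriv (e # es) v)"
        using v len lists.Cons[OF \<open>e \<in> range ex\<close> es] unfolding Cm2_closure_def by (metis Suc_leI length_Cons)
      then show "extends_to_closure U (dir_deriv (ex i) (iter_deriv es v))" by (simp add: e)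
      show "has_dir_deriv (ex i) (iter_deriv es v) q" if "q \<in> U" for q
        using v es len that by (auto simp: Cm2_closure_def Cm2_def Ck_along_def)
    qed
    ultimately show "has_dir_deriv e (iter_deriv es (scaled_mean a b w l v)) p" by simp
  }
qed

lemma Cm2_closure_time:
  fixes v :: "(real^'n) \<times> real \<Rightarrow> 'k::euclidean_space"
  assumes "Cm2_closure m U v"
  shows "extends_to_closure U v" "extends_to_closure U (partial_t v)"
    "extends_to_closure U (partial_t (partial_t v))"
    "\<And>q. q \<in> U \<Longrightarrow> has_dir_deriv et v q" "\<And>q. q \<in> U \<Longrightarrow> has_dir_deriv et (partial_t v) q"
proof -
  have ext: "extends_to_closure U (iter_deriv es v)" if "es \<in> lists {et}" "length es \<le> 2" for es
    using assms that by (auto simp: Cm2_closure_def)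
  show "extends_to_closure U v" using ext[of "[]"] by simp
  show "extends_to_closure U (partial_t v)" using ext[of "[et]"] by simp
  show "extends_to_closure U (partial_t (partial_t v))" using ext[of "[et, et]"] by simp
  have diff: "has_dir_deriv et (iter_deriv es v) q" if "es \<in> lists {et}" "length es < 2" "q \<in> U" for es q
    using assms that by (auto simp: Cm2_closure_def Cm2_def Ck_along_def)
  show "has_dir_deriv et v q" if "q \<in> U" for q using diff[of "[]"] that by simp
  show "has_dir_deriv et (partial_t v) q" if "q \<in> U" for q using diff[of "[et]"] that by simp
qed

text \<open>
  With \<open>P = a + b t\<close> and \<open>\<phi>' = t\<^sup>l\<^sup>/\<^sup>2\<close>, the next two expressions are the first and second time derivatives
  of \<open>scaled_mean a b w l f\<close>, where \<open>f1\<close> and \<open>f2\<close> stand for the first two time derivatives of \<open>f\<close>.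
\<close>

definition scaled_mean_t where
  "scaled_mean_t a b w f f1 p = b *\<^sub>R weighted_mean w l f p +
    ((a + b * snd p) * snd p powr (l / 2)) *\<^sub>R weighted_mean (\<lambda>s. s * w s) l f1 p"

definition scaled_mean_tt where
  "scaled_mean_tt a b w f1 f2 p =
    (2 * b * snd p powr (l / 2) + (a + b * snd p) * (l / 2 * snd p powr (l / 2 - 1))) *\<^sub>R
      weighted_mean (\<lambda>s. s * w s) l f1 p +
    ((a + b * snd p) * snd p powr l) *\<^sub>R weighted_mean (\<lambda>s. s * (s * w s)) l f2 p"

text \<open>
  The product rule, with each weighted mean differentiated as \<open>\<phi>'\<close> times the next one. In the second
  derivative \<open>\<phi>' \<phi>' = t\<^sup>l\<close> appears in front of the mean of the second time derivative.
\<close>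

lemma scaled_mean_has_derivative_t:
  fixes v :: "(real^'n) \<times> real \<Rightarrow> 'k::euclidean_space"
  assumes w: "set_integrable lborel {0<..<1} w" and v: "Cm2_closure m U v" and p: "p \<in> \<Omega>"
  shows "((\<lambda>h. scaled_mean a b w l v (p + h *\<^sub>R et)) has_vector_derivative
      scaled_mean_t a b w v (partial_t v) p) (at 0)"
    and "((\<lambda>h. scaled_mean_t a b w v (partial_t v) (p + h *\<^sub>R et)) has_vector_derivative
      scaled_mean_tt a b w (partial_t v) (partial_t (partial_t v)) p) (at 0)"
proof -
  note v = Cm2_closure_time[OF v]
  obtain g0 g1 g2 where g: "continuous_extension U v g0" "continuous_extension U (partial_t v) g1"
      "continuous_extension U (partial_t (partial_t v)) g2"
    using v(1-3) extends_to_closureE by metis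
  have sw: "set_integrable lborel {0<..<1} (\<lambda>s. s * w s)"
    by (intro set_integrable_weight_mult w continuous_on_id)
  define t where "t = snd p"
  have t: "0 < t" using time_pos[OF p] by (simp add: t_def)
  define J0 where "J0 = (\<lambda>h. weighted_mean w l v (p + h *\<^sub>R et))"
  define J1 where "J1 = (\<lambda>h. weighted_mean (\<lambda>s. s * w s) l (partial_t v) (p + h *\<^sub>R et))"
  define J2 where "J2 = weighted_mean (\<lambda>s. s * (s * w s)) l (partial_t (partial_t v)) p"
  have J0: "(J0 has_vector_derivative t powr (l / 2) *\<^sub>R J1 0) (at 0)"
    using weighted_mean_has_derivative_t[OF w g(1,2) v(4) p] by (simp add: J0_def J1_def t_def)
  have J1: "(J1 has_vector_derivative t powr (l / 2) *\<^sub>R J2) (at 0)"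
    using weighted_mean_has_derivative_t[OF sw g(2,3) v(5) p] by (simp add: J1_def J2_def t_def)
  have S: "scaled_mean a b w l v (p + h *\<^sub>R et) = (a + b * (t + h)) *\<^sub>R J0 h" for h
    by (simp add: scaled_mean_def J0_def t_def et_def)
  have S_t: "scaled_mean_t a b w v (partial_t v) (p + h *\<^sub>R et) =
      b *\<^sub>R J0 h + ((a + b * (t + h)) * (t + h) powr (l / 2)) *\<^sub>R J1 h" for h
    unfolding scaled_mean_t_def J0_def J1_def t_def by (simp add: et_def)
  have lin: "((\<lambda>h. a + b * (t + h)) has_real_derivative b) (at 0)"
    by (auto intro!: derivative_eq_intros)
  have "((\<lambda>h. (a + b * (t + h)) *\<^sub>R J0 h) has_vector_derivative
      (a + b * (t + 0)) *\<^sub>R (t powr (l / 2) *\<^sub>R J1 0) + b *\<^sub>R J0 0) (at 0)"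
    by (intro has_vector_derivative_scaleR lin J0)
  then show "((\<lambda>h. scaled_mean a b w l v (p + h *\<^sub>R et)) has_vector_derivative
      scaled_mean_t a b w v (partial_t v) p) (at 0)"
    unfolding S by (simp add: scaled_mean_t_def J0_def J1_def t_def add.commute)
  have pw: "((\<lambda>h. (t + h) powr (l / 2)) has_real_derivative l / 2 * t powr (l / 2 - 1)) (at 0)"
    using t by (auto intro!: derivative_eq_intros)
  have "((\<lambda>h. (a + b * (t + h)) * (t + h) powr (l / 2)) has_real_derivative
      b * (t + 0) powr (l / 2) + l / 2 * t powr (l / 2 - 1) * (a + b * (t + 0))) (at 0)"
    by (rule DERIV_mult[OF lin pw])
  from has_vector_derivative_add[OF bounded_linear.has_vector_derivative[OF bounded_linear_scaleR_right J0]
      has_vector_derivative_scaleR[OF this J1]]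
  have "((\<lambda>h. b *\<^sub>R J0 h + ((a + b * (t + h)) * (t + h) powr (l / 2)) *\<^sub>R J1 h) has_vector_derivative
      b *\<^sub>R (t powr (l / 2) *\<^sub>R J1 0) + (((a + b * (t + 0)) * (t + 0) powr (l / 2)) *\<^sub>R (t powr (l / 2) *\<^sub>R J2) +
      (b * (t + 0) powr (l / 2) + l / 2 * t powr (l / 2 - 1) * (a + b * (t + 0))) *\<^sub>R J1 0)) (at 0)" .
  moreover have "b *\<^sub>R (t powr (l / 2) *\<^sub>R J1 0) + (((a + b * (t + 0)) * (t + 0) powr (l / 2)) *\<^sub>R (t powr (l / 2) *\<^sub>R J2) +
      (b * (t + 0) powr (l / 2) + l / 2 * t powr (l / 2 - 1) * (a + b * (t + 0))) *\<^sub>R J1 0) =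
      scaled_mean_tt a b w (partial_t v) (partial_t (partial_t v)) p"
  proof -
    have "t powr l = t powr (l / 2) * t powr (l / 2)"
      by (simp add: powr_add[symmetric])
    \<comment> \<open>The product \<open>b \<phi>' J\<close> arises twice, once from each summand of the first derivative.\<close>
    moreover have two: "(2 * b * t powr (l / 2) + d) *\<^sub>R J =
        b *\<^sub>R (t powr (l / 2) *\<^sub>R J) + (b * t powr (l / 2) + d) *\<^sub>R J" for d and J :: 'k
    proof -
      have "2 * b * t powr (l / 2) + d = b * t powr (l / 2) + (b * t powr (l / 2) + d)" by simp
      then show ?thesis by (simp only: scaleR_add_left scaleR_scaleR)
    qed
    ultimately show ?thesis
      unfolding scaled_mean_tt_def t_def[symmetric] J2_def[symmetric] two
      by (simp add: J1_def algebra_simps)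
  qed
  ultimately show "((\<lambda>h. scaled_mean_t a b w v (partial_t v) (p + h *\<^sub>R et)) has_vector_derivative
      scaled_mean_tt a b w (partial_t v) (partial_t (partial_t v)) p) (at 0)"
    unfolding S_t by simp
qed

lemma partial_t_scaled_mean:
  fixes v :: "(real^'n) \<times> real \<Rightarrow> 'k::euclidean_space"
  assumes w: "set_integrable lborel {0<..<1} w" and v: "Cm2_closure m U v" and p: "p \<in> \<Omega>"
  shows "has_dir_deriv et (scaled_mean a b w l v) p"
    "partial_t (scaled_mean a b w l v) p = scaled_mean_t a b w v (partial_t v) p"
    "has_dir_deriv et (partial_t (scaled_mean a b w l v)) p"
    "partial_t (partial_t (scaled_mean a b w l v)) p =
      scaled_mean_tt a b w (partial_t v) (partial_t (partial_t v)) p"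
proof -
  note D = scaled_mean_has_derivative_t[OF w v]
  have first: "partial_t (scaled_mean a b w l v) q = scaled_mean_t a b w v (partial_t v) q"
    if "q \<in> \<Omega>" for q by (rule dir_derivI[OF D(1)[OF that]])
  have cong: "dir_deriv et (partial_t (scaled_mean a b w l v)) p =
      dir_deriv et (scaled_mean_t a b w v (partial_t v)) p"
    "has_dir_deriv et (partial_t (scaled_mean a b w l v)) p \<longleftrightarrow>
      has_dir_deriv et (scaled_mean_t a b w v (partial_t v)) p"
    by (rule dir_deriv_cong_open[OF open_domain p]; rule first; assumption)+
  show "partial_t (scaled_mean a b w l v) p = scaled_mean_t a b w v (partial_t v) p"
    by (rule first[OF p])
  show "has_dir_deriv et (scaled_mean a b w l v) p" by (rule dir_derivI[OF D(1)[OF p]])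
  show "has_dir_deriv et (partial_t (scaled_mean a b w l v)) p"
    using dir_derivI(2)[OF D(2)[OF p]] cong(2) by simp
  show "partial_t (partial_t (scaled_mean a b w l v)) p =
      scaled_mean_tt a b w (partial_t v) (partial_t (partial_t v)) p"
    using dir_derivI(1)[OF D(2)[OF p]] cong(1) by simp
qed

lemma Cm2_scaled_mean:
  fixes v :: "(real^'n) \<times> real \<Rightarrow> 'k::euclidean_space"
  assumes w: "set_integrable lborel {0<..<1} w" and v: "Cm2_closure m U v"
  shows "Cm2 m \<Omega> (scaled_mean a b w l v)"
  unfolding Cm2_def
proof
  show "Ck_along (range ex) m \<Omega> (scaled_mean a b w l v)"
    by (rule Ck_along_x_scaled_mean[OF w v])
  note v' = Cm2_closure_time[OF v] and D = partial_t_scaled_mean[OF w v]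
  have sw: "set_integrable lborel {0<..<1} (\<lambda>s. s * w s)"
    by (intro set_integrable_weight_mult w continuous_on_id)
  have ssw: "set_integrable lborel {0<..<1} (\<lambda>s. s * (s * w s))"
    by (intro set_integrable_weight_mult sw continuous_on_id)
  \<comment> \<open>For \<open>a = 1\<close> and \<open>b = 0\<close> the scaled mean is the weighted mean itself.\<close>
  note cont = continuous_on_scaled_mean[of _ _ 1 0, unfolded scaled_mean_def, simplified]
  have nz: "\<forall>p\<in>\<Omega>. snd p \<noteq> 0" using time_pos by fastforce
  have c0: "continuous_on \<Omega> (scaled_mean a b w l v)"
    by (rule continuous_on_scaled_mean[OF w v'(1)])
  have "continuous_on \<Omega> (scaled_mean_t a b w v (partial_t v))"
    unfolding scaled_mean_t_def[abs_def]
    by (intro continuous_intros cont w sw v') (use nz in auto)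
  then have c1: "continuous_on \<Omega> (partial_t (scaled_mean a b w l v))"
    by (subst continuous_on_cong[OF refl D(2)])
  have "continuous_on \<Omega> (scaled_mean_tt a b w (partial_t v) (partial_t (partial_t v)))"
    unfolding scaled_mean_tt_def[abs_def]
    by (intro continuous_intros cont sw ssw v') (use nz in auto)
  then have c2: "continuous_on \<Omega> (partial_t (partial_t (scaled_mean a b w l v)))"
    by (subst continuous_on_cong[OF refl D(4)])
  have lists: "es = replicate (length es) et" if "es \<in> lists {et}" for es :: "((real^'n) \<times> real) list"
    using that by (induction es) auto
  show "Ck_along {et} 2 \<Omega> (scaled_mean a b w l v)"
    unfolding Ck_along_def
  proof (intro conjI ballI impI)
    fix es :: "((real^'n) \<times> real) list" assume es: "es \<in> lists {et}"
    {
      assume "length es \<le> 2"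
      then have "length es = 0 \<or> length es = 1 \<or> length es = 2" by linarith
      then have "es = [] \<or> es = [et] \<or> es = [et, et]"
        using lists[OF es] by (auto simp: numeral_2_eq_2)
      then show "continuous_on \<Omega> (iter_deriv es (scaled_mean a b w l v))"
        using c0 c1 c2 by auto
    next
      fix e :: "(real^'n) \<times> real" and p assume "length es < 2" and e: "e \<in> {et}" and p: "p \<in> \<Omega>"
      then have "length es = 0 \<or> length es = 1" by linarith
      then have "es = [] \<or> es = [et]"
        using lists[OF es] by auto
      then show "has_dir_deriv e (iter_deriv es (scaled_mean a b w l v)) p"
        using D(1,3)[OF p] e by auto
    }
  qed
qed

text \<open>
  The point \<open>(x, 0)\<close> is a limit point of the \<open>\<phi>\<close>-image along the vertical segment above it; otherwise the
  limit that defines the initial value would carry no information.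
\<close>

lemma initial_value_eq:
  fixes f :: "(real^'n) \<times> real \<Rightarrow> 'k::euclidean_space"
  assumes g: "continuous_extension U f g" and x: "x \<in> fst ` \<Omega>"
  shows "initial_value U f x = g (x, 0)"
proof -
  obtain t where t: "(x, t) \<in> \<Omega>" using x by auto
  note phi_pos[OF l_pos time_pos[OF t]]
  then have pos: "0 < phi l t" by simp
  have "(x, 0) islimpt U"
    unfolding islimpt_approachable
  proof (intro allI impI)
    fix e :: real assume "0 < e"
    let ?q = "(x, min (e / 2) (phi l t))"
    have "?q \<in> U" using t pos \<open>0 < e\<close> by (auto simp: phi_image_def intro!: bexI[OF _ t])
    moreover have "?q \<noteq> (x, 0)" "dist ?q (x, 0) < e"
      using pos \<open>0 < e\<close> by (auto simp: dist_Pair_Pair)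
    ultimately show "\<exists>x'\<in>U. x' \<noteq> (x, 0) \<and> dist x' (x, 0) < e" by blast
  qed
  then have "at (x, 0) within U \<noteq> bot" by (simp add: trivial_limit_within)
  moreover have "(g \<longlongrightarrow> g (x, 0)) (at (x, 0) within U)"
    using g by (auto simp: continuous_extension_def continuous_on_def intro: tendsto_within_subset)
  then have "(f \<longlongrightarrow> g (x, 0)) (at (x, 0) within U)"
  proof (rule Lim_transform_eventually)
    show "\<forall>\<^sub>F q in at (x, 0) within U. g q = f q"
      using g by (auto simp: continuous_extension_def eventually_at_filter)
  qed
  ultimately show ?thesis unfolding initial_value_def by (rule tendsto_Lim)
qed

text \<open>
  At \<open>t = 0\<close> the segment shrinks to the point \<open>(x, 0)\<close> because \<open>\<phi>(0) = 0\<close>, and the extension is constant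
  under the integral.
\<close>

lemma weighted_mean_tendsto_initial:
  fixes f :: "(real^'n) \<times> real \<Rightarrow> 'k::euclidean_space"
  assumes w: "set_integrable lborel {0<..<1} w" and f: "extends_to_closure U f" and x: "x \<in> fst ` \<Omega>"
  shows "(weighted_mean w l f \<longlongrightarrow>
    (LINT s:{0<..<1}|lborel. w s) *\<^sub>R initial_value U f x) (at (x, 0) within \<Omega>)"
proof -
  obtain g where g: "continuous_extension U f g" using f by (rule extends_to_closureE)
  have "continuous_on {p. 0 \<le> snd p} (weighted_mean w l g)"
    using g by (intro continuous_on_weighted_mean l_pos w) (simp add: continuous_extension_def)
  then have "(weighted_mean w l g \<longlongrightarrow> weighted_mean w l g (x, 0)) (at (x, 0) within {p. 0 \<le> snd p})"
    by (auto simp: continuous_on_def)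
  then have "(weighted_mean w l g \<longlongrightarrow> weighted_mean w l g (x, 0)) (at (x, 0) within \<Omega>)"
    by (rule tendsto_within_subset) (use time_pos in \<open>auto intro: less_imp_le\<close>)
  moreover have "weighted_mean w l g (x, 0) = (LINT s:{0<..<1}|lborel. w s) *\<^sub>R initial_value U f x"
    unfolding initial_value_eq[OF g x] using w
    by (simp add: weighted_mean_def set_lebesgue_integral_def set_integrable_def)
  moreover have "\<forall>\<^sub>F q in at (x, 0) within \<Omega>. weighted_mean w l g q = weighted_mean w l f q"
    unfolding eventually_at_filter
    by (intro always_eventually allI impI weighted_mean_cong)
      (use g in \<open>auto simp: continuous_extension_def\<close>)
  ultimately show ?thesis by (auto intro: Lim_transform_eventually)
qed

text \<open>
  In the time derivative the mean of the initial velocity is multiplied by \<open>t\<^sup>l\<^sup>/\<^sup>2\<close>, which tends to \<open>0\<close> as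
  \<open>l > 0\<close>; only the term from differentiating \<open>a + b t\<close> survives.
\<close>

lemma scaled_mean_initial_values:
  fixes v :: "(real^'n) \<times> real \<Rightarrow> 'k::euclidean_space"
  assumes w: "set_integrable lborel {0<..<1} w" and v: "Cm2_closure m U v" and x: "x \<in> fst ` \<Omega>"
  shows "(scaled_mean a b w l v \<longlongrightarrow>
      (a * (LINT s:{0<..<1}|lborel. w s)) *\<^sub>R initial_value U v x) (at (x, 0) within \<Omega>)"
    and "(partial_t (scaled_mean a b w l v) \<longlongrightarrow>
      (b * (LINT s:{0<..<1}|lborel. w s)) *\<^sub>R initial_value U v x) (at (x, 0) within \<Omega>)"
proof -
  let ?F = "at (x, 0) within \<Omega>" and ?W = "LINT s:{0<..<1}|lborel. w s"
  have snd0: "(snd \<longlongrightarrow> 0) ?F"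
    using tendsto_snd[OF tendsto_ident_at[of "(x, 0 :: real)" \<Omega>]] by simp
  have lin: "((\<lambda>p. a + b * snd p) \<longlongrightarrow> a + b * 0) ?F"
    by (intro tendsto_intros snd0)
  have pw: "((\<lambda>p. snd p powr (l / 2)) \<longlongrightarrow> 0 powr (l / 2)) ?F"
  proof (rule tendsto_powr'[OF snd0 tendsto_const])
    have "\<forall>\<^sub>F p in ?F. 0 \<le> snd p"
      unfolding eventually_at_filter
      by (intro always_eventually allI impI) (use time_pos in \<open>auto intro: less_imp_le\<close>)
    then show "0 \<noteq> 0 \<or> 0 < l / 2 \<and> (\<forall>\<^sub>F p in ?F. 0 \<le> snd p)" using l_pos by simp
  qed
  note v' = Cm2_closure_time[OF v]
  have sw: "set_integrable lborel {0<..<1} (\<lambda>s. s * w s)"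
    by (intro set_integrable_weight_mult w continuous_on_id)
  note J = weighted_mean_tendsto_initial[OF _ _ x]
  show "(scaled_mean a b w l v \<longlongrightarrow> (a * ?W) *\<^sub>R initial_value U v x) ?F"
    using tendsto_scaleR[OF lin J[OF w v'(1)]] by (simp add: scaled_mean_def[abs_def])
  have "(scaled_mean_t a b w v (partial_t v) \<longlongrightarrow> b *\<^sub>R (?W *\<^sub>R initial_value U v x) +
      ((a + b * 0) * 0 powr (l / 2)) *\<^sub>R
        ((LINT s:{0<..<1}|lborel. s * w s) *\<^sub>R initial_value U (partial_t v) x)) ?F"
    unfolding scaled_mean_t_def[abs_def]
    by (intro tendsto_add tendsto_scaleR tendsto_mult tendsto_const lin pw J w sw v')
  then have "(scaled_mean_t a b w v (partial_t v) \<longlongrightarrow> (b * ?W) *\<^sub>R initial_value U v x) ?F"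
    by simp
  moreover have "\<forall>\<^sub>F q in ?F. scaled_mean_t a b w v (partial_t v) q = partial_t (scaled_mean a b w l v) q"
    unfolding eventually_at_filter
    by (intro always_eventually allI impI partial_t_scaled_mean(2)[OF w v, symmetric])
  ultimately show "(partial_t (scaled_mean a b w l v) \<longlongrightarrow> (b * ?W) *\<^sub>R initial_value U v x) ?F"
    by (rule Lim_transform_eventually)
qed

section \<open>The transformed equation\<close>

text \<open>
  The difference of means on the left is the mean with weight \<open>(1 - s\<^sup>2)\<^sup>\<beta>\<close>, to which integration by
  parts applies with \<open>c = \<phi>(t)\<close> and \<open>Y = \<partial>\<^sub>tv(x, \<cdot>)\<close>, extended continuously to \<open>0\<close>.
\<close>

lemma partial_t_by_parts:
  fixes v :: "(real^'n) \<times> real \<Rightarrow> 'k::euclidean_space"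
  assumes "0 < \<beta>" and v: "Cm2_closure m U v" and p: "p \<in> \<Omega>"
  shows "phi l (snd p) *\<^sub>R
      (weighted_mean (euler_weight \<beta>) l (partial_t (partial_t v)) p -
       weighted_mean (\<lambda>s. s * (s * euler_weight \<beta> s)) l (partial_t (partial_t v)) p) =
    (2 * \<beta>) *\<^sub>R weighted_mean (\<lambda>s. s * euler_weight \<beta> s) l (partial_t v) p -
      initial_value U (partial_t v) (fst p)"
proof -
  note w = euler_weight_integral(1)[OF \<open>0 < \<beta>\<close>] and v' = Cm2_closure_time[OF v]
  obtain g1 g2 where g: "continuous_extension U (partial_t v) g1"
      "continuous_extension U (partial_t (partial_t v)) g2"
    using v'(2,3) extends_to_closureE by metis
  then have cont: "continuous_on UNIV g1" "continuous_on UNIV g2"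
    and eq: "\<And>q. q \<in> U \<Longrightarrow> partial_t v q = g1 q" "\<And>q. q \<in> U \<Longrightarrow> partial_t (partial_t v) q = g2 q"
    by (auto simp: continuous_extension_def)
  define c where "c = phi l (snd p)"
  have c: "0 < c" unfolding c_def by (rule phi_pos[OF l_pos time_pos[OF p]])
  have inU: "(fst p, \<tau>) \<in> U" if "0 < \<tau>" "\<tau> < c" for \<tau>
    using mem_phi_image[OF p, of "\<tau> / c"] that c by (simp add: c_def)
  have parts: "c *\<^sub>R (LINT s:{0<..<1}|lborel. ((1 - s\<^sup>2) * euler_weight \<beta> s) *\<^sub>R g2 (fst p, c * s)) =
    (2 * \<beta>) *\<^sub>R (LINT s:{0<..<1}|lborel. (s * euler_weight \<beta> s) *\<^sub>R g1 (fst p, c * s)) - g1 (fst p, 0)"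
  proof (rule euler_weight_by_parts[OF \<open>0 < \<beta>\<close> c, where Y = "\<lambda>\<tau>. g1 (fst p, \<tau>)"])
    show "continuous_on {0..c} (\<lambda>\<tau>. g1 (fst p, \<tau>))" "continuous_on {0..c} (\<lambda>\<tau>. g2 (fst p, \<tau>))"
      by (intro continuous_on_compose2[OF cont(1)] continuous_on_compose2[OF cont(2)] continuous_intros; simp)+
    fix \<tau> assume \<tau>: "0 < \<tau>" "\<tau> < c"
    have "((\<lambda>k. partial_t v ((fst p, 0) + k *\<^sub>R et)) has_vector_derivative
        partial_t (partial_t v) ((fst p, 0) + \<tau> *\<^sub>R et)) (at \<tau>)"
      by (rule has_vector_derivative_along_line[OF v'(5)]) (use inU[OF \<tau>] in \<open>simp add: et_def\<close>)
    then have "((\<lambda>k. partial_t v (fst p, k)) has_vector_derivative g2 (fst p, \<tau>)) (at \<tau>)"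
      using eq(2)[OF inU[OF \<tau>]] by (simp add: et_def)
    then show "((\<lambda>\<tau>. g1 (fst p, \<tau>)) has_vector_derivative g2 (fst p, \<tau>)) (at \<tau>)"
      by (rule has_vector_derivative_transform_within_open[where S = "{0<..<c}"])
        (use \<tau> inU eq(1) in auto)
  qed
  have cong1: "weighted_mean u l (partial_t v) p = weighted_mean u l g1 p" for u
    by (rule weighted_mean_cong[OF p]) (rule eq)
  have cong2: "weighted_mean u l (partial_t (partial_t v)) p = weighted_mean u l g2 p" for u
    by (rule weighted_mean_cong[OF p]) (rule eq)
  have ssw: "set_integrable lborel {0<..<1} (\<lambda>s. s * (s * euler_weight \<beta> s))"
    by (intro set_integrable_weight_mult w continuous_on_id)
  have "weighted_mean (euler_weight \<beta>) l g2 p - weighted_mean (\<lambda>s. s * (s * euler_weight \<beta> s)) l g2 p =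
      (LINT s:{0<..<1}|lborel. euler_weight \<beta> s *\<^sub>R g2 (fst p, c * s) -
        (s * (s * euler_weight \<beta> s)) *\<^sub>R g2 (fst p, c * s))"
    unfolding weighted_mean_def c_def
    by (rule set_integral_diff(2)[symmetric]; intro set_integrable_weighted_mean w ssw cont)
  also have "\<dots> = (LINT s:{0<..<1}|lborel. ((1 - s\<^sup>2) * euler_weight \<beta> s) *\<^sub>R g2 (fst p, c * s))"
    by (simp add: algebra_simps power2_eq_square)
  finally show ?thesis
    using parts unfolding cong1 cong2 initial_value_eq[OF g(1) imageI[OF p]]
    by (simp add: weighted_mean_def c_def)
qed

lemma partial_x_scaled_mean:
  fixes v :: "(real^'n) \<times> real \<Rightarrow> 'k::euclidean_space"
  assumes w: "set_integrable lborel {0<..<1} w" and v: "Cm2_closure m U v"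
    and \<alpha>: "\<alpha> \<in> multi_indices m"
  shows "p \<in> \<Omega> \<Longrightarrow> partial_x \<alpha> (scaled_mean a b w l v) p = scaled_mean a b w l (partial_x \<alpha> v) p"
    and "extends_to_closure U (partial_x \<alpha> v)"
proof -
  define es :: "((real^'n) \<times> real) list"
    where "es = concat (map (\<lambda>i. replicate (\<alpha> i) (ex i)) enumeration)"
  have "length es = sum_list (map \<alpha> enumeration)"
    by (simp add: es_def length_concat o_def)
  also have "\<dots> = (\<Sum>i\<in>UNIV. \<alpha> i)"
    using enumeration by (metis sum_list_distinct_conv_sum_set)
  also have "\<dots> \<le> m" using \<alpha> by (simp add: multi_indices_def)
  finally have len: "length es \<le> m" .
  have es: "es \<in> lists (range ex)" by (auto simp: es_def)
  show "p \<in> \<Omega> \<Longrightarrow> partial_x \<alpha> (scaled_mean a b w l v) p = scaled_mean a b w l (partial_x \<alpha> v) p"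
    using iter_deriv_scaled_mean_x[OF w v es len] by (simp add: partial_x_def es_def)
  show "extends_to_closure U (partial_x \<alpha> v)"
    using v es len by (simp add: Cm2_closure_def partial_x_def es_def)
qed

text \<open>
  The coefficients depend on \<open>x\<close> only and can be taken under the integral.
\<close>

lemma diff_op_scaled_mean:
  fixes v :: "(real^'n) \<times> real \<Rightarrow> 'k::{real_normed_field, euclidean_space}"
  assumes w: "set_integrable lborel {0<..<1} w" and v: "Cm2_closure m U v" and p: "p \<in> \<Omega>"
  shows "diff_op m A (scaled_mean a b w l v) p = scaled_mean a b w l (diff_op m A v) p"
proof -
  define q where "q = (\<lambda>s. (fst p, phi l (snd p) * s))"
  have int: "set_integrable lborel {0<..<1} (\<lambda>s. w s *\<^sub>R partial_x \<alpha> v (q s))"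
    if \<alpha>: "\<alpha> \<in> multi_indices m" for \<alpha>
  proof -
    obtain g where "continuous_extension U (partial_x \<alpha> v) g"
      by (rule extends_to_closureE[OF partial_x_scaled_mean(2)[OF w v \<alpha>]])
    then show ?thesis
      unfolding q_def by (rule set_integrable_weighted_mean_extension[OF w _ p])
  qed
  have "weighted_mean w l (diff_op m A v) p =
      (LINT s:{0<..<1}|lborel. \<Sum>\<alpha>\<in>multi_indices m. A \<alpha> (fst p) * (w s *\<^sub>R partial_x \<alpha> v (q s)))"
    by (simp add: weighted_mean_def diff_op_def q_def scaleR_sum_right)
  also have "\<dots> = (\<Sum>\<alpha>\<in>multi_indices m. LINT s:{0<..<1}|lborel. A \<alpha> (fst p) * (w s *\<^sub>R partial_x \<alpha> v (q s)))"
  proof -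
    have "integrable lborel (\<lambda>s. indicator {0<..<1} s *\<^sub>R (A \<alpha> (fst p) * (w s *\<^sub>R partial_x \<alpha> v (q s))))"
      if "\<alpha> \<in> multi_indices m" for \<alpha>
      using set_integrable_mult_right[OF int[OF that], of "A \<alpha> (fst p)"] by (simp add: set_integrable_def)
    then show ?thesis
      unfolding set_lebesgue_integral_def scaleR_sum_right by (rule Bochner_Integration.integral_sum)
  qed
  also have "\<dots> = (\<Sum>\<alpha>\<in>multi_indices m. A \<alpha> (fst p) * weighted_mean w l (partial_x \<alpha> v) p)"
    unfolding weighted_mean_def q_def by (simp only: set_integral_mult_right)
  finally have "scaled_mean a b w l (diff_op m A v) p =
      (\<Sum>\<alpha>\<in>multi_indices m. A \<alpha> (fst p) * scaled_mean a b w l (partial_x \<alpha> v) p)"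
    by (simp add: scaled_mean_def scaleR_sum_right)
  also have "\<dots> = diff_op m A (scaled_mean a b w l v) p"
    unfolding diff_op_def by (intro sum.cong refl) (simp add: partial_x_scaled_mean(1)[OF w v _ p])
  finally show ?thesis ..
qed

text \<open>
  Put \<open>P = a + b t\<close>, and let \<open>S\<close>, \<open>Q\<close>, \<open>R\<close> be the means of \<open>\<partial>\<^sub>tv\<close>, \<open>\<partial>\<^sub>t\<^sup>2v\<close>, \<open>\<partial>\<^sub>t\<^sup>2v\<close> with weights
  \<open>s w\<close>, \<open>w\<close>, \<open>s\<^sup>2 w\<close>. The equation for \<open>v\<close> turns \<open>t\<^sup>l A u\<close> into \<open>P t\<^sup>l Q\<close>, so the left-hand side is
  \<open>(2 P' \<phi>' + P \<phi>'') S - P t\<^sup>l (Q - R)\<close>. Integration by parts expresses \<open>Q - R\<close> through \<open>S\<close> and the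
  initial velocity. The conditions on \<open>a\<close>, \<open>b\<close> and \<open>\<beta>\<close> say precisely that the two terms in \<open>S\<close> cancel.
\<close>

lemma scaled_mean_equation:
  fixes v :: "(real^'n) \<times> real \<Rightarrow> 'k::{real_normed_field, euclidean_space}"
  assumes "0 < \<beta>" and v: "Cm2_closure m U v"
    and eq: "\<And>q. q \<in> U \<Longrightarrow> partial_t (partial_t v) q - diff_op m A v q = 0"
    and p: "p \<in> \<Omega>"
    and a: "a = 0 \<or> \<beta> * (l + 2) = l / 2" and b: "b = 0 \<or> \<beta> * (l + 2) = l / 2 + 2"
  defines "u \<equiv> scaled_mean a b (euler_weight \<beta>) l v"
  shows "partial_t (partial_t u) p - (snd p powr l) *\<^sub>R diff_op m A u p =
    ((a + b * snd p) * ((l + 2) / 2) * snd p powr (l / 2 - 1)) *\<^sub>R initial_value U (partial_t v) (fst p)"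
proof -
  note w = euler_weight_integral(1)[OF \<open>0 < \<beta>\<close>]
  define t where "t = snd p"
  define P where "P = a + b * t"
  define S where "S = weighted_mean (\<lambda>s. s * euler_weight \<beta> s) l (partial_t v) p"
  define Q where "Q = weighted_mean (euler_weight \<beta>) l (partial_t (partial_t v)) p"
  define R where "R = weighted_mean (\<lambda>s. s * (s * euler_weight \<beta> s)) l (partial_t (partial_t v)) p"
  define I where "I = initial_value U (partial_t v) (fst p)"
  have t: "0 < t" using time_pos[OF p] by (simp add: t_def)
  have half: "t powr (l / 2) = t * t powr (l / 2 - 1)"
    using t by (simp add: powr_mult_base)
  \<comment> \<open>Integration by parts brings a factor \<open>\<phi>\<close>, so \<open>t\<^sup>l\<close> is written as a multiple of \<open>\<phi>\<close>.\<close>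
  have full: "t powr l = (l + 2) / 2 * t powr (l / 2 - 1) * phi l t"
  proof -
    have "t powr (l / 2 - 1) * t powr ((l + 2) / 2) = t powr l"
      by (simp add: powr_add[symmetric] field_simps)
    then show ?thesis using l_pos by (simp add: phi_def field_simps)
  qed
  have parts: "phi l t *\<^sub>R (Q - R) = (2 * \<beta>) *\<^sub>R S - I"
    unfolding Q_def R_def S_def I_def t_def by (rule partial_t_by_parts[OF \<open>0 < \<beta>\<close> v p])
  have "diff_op m A u p = scaled_mean a b (euler_weight \<beta>) l (diff_op m A v) p"
    unfolding u_def by (rule diff_op_scaled_mean[OF w v p])
  also have "\<dots> = P *\<^sub>R weighted_mean (euler_weight \<beta>) l (diff_op m A v) p"
    by (simp add: scaled_mean_def P_def t_def)
  also have "weighted_mean (euler_weight \<beta>) l (diff_op m A v) p = Q"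
    unfolding Q_def by (rule weighted_mean_cong[OF p]) (use eq in auto)
  finally have op: "diff_op m A u p = P *\<^sub>R Q" .
  have "partial_t (partial_t u) p = (2 * b * t powr (l / 2) + P * (l / 2 * t powr (l / 2 - 1))) *\<^sub>R S +
      (P * t powr l) *\<^sub>R R"
    unfolding u_def partial_t_scaled_mean(4)[OF w v p]
    by (simp add: scaled_mean_tt_def P_def S_def R_def t_def)
  also have "2 * b * t powr (l / 2) + P * (l / 2 * t powr (l / 2 - 1)) =
      P * (\<beta> * (l + 2)) * t powr (l / 2 - 1)"
  proof -
    define B where "B = \<beta> * (l + 2)"
    have aB: "a * B = a * (l / 2)" and bB: "b * B = b * (l / 2 + 2)"
      using a b unfolding B_def[symmetric] by auto
    have "P * B = a * B + t * (b * B)" by (simp add: P_def algebra_simps)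
    also have "\<dots> = a * (l / 2) + t * (b * (l / 2 + 2))" by (simp only: aB bB)
    finally show ?thesis
      unfolding half B_def[symmetric] by (simp add: P_def algebra_simps)
  qed
  finally have "partial_t (partial_t u) p - (t powr l) *\<^sub>R diff_op m A u p =
      (P * (\<beta> * (l + 2)) * t powr (l / 2 - 1)) *\<^sub>R S - (P * t powr l) *\<^sub>R (Q - R)"
    unfolding op by (simp add: algebra_simps)
  also have "(P * t powr l) *\<^sub>R (Q - R) = (P * ((l + 2) / 2) * t powr (l / 2 - 1)) *\<^sub>R (phi l t *\<^sub>R (Q - R))"
    unfolding full by (simp add: mult_ac)
  also have "\<dots> = (P * (\<beta> * (l + 2)) * t powr (l / 2 - 1)) *\<^sub>R S - (P * ((l + 2) / 2) * t powr (l / 2 - 1)) *\<^sub>R I"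
    unfolding parts by (simp add: scaleR_diff_right mult_ac)
  finally show ?thesis by (simp add: P_def t_def I_def)
qed

end

section \<open>The operators \<open>K\<^sub>0\<close> and \<open>K\<^sub>1\<close>\<close>

lemma K0_eq_scaled_mean:
  "K0 l v = scaled_mean (2 powr (2 - 2 * gam l) * Gamma (2 * gam l) / (Gamma (gam l))\<^sup>2) 0
    (euler_weight (gam l)) l v"
  by (simp add: fun_eq_iff K0_def scaled_mean_def weighted_mean_def euler_weight_def
      interval_lebesgue_integral_def zero_ereal_def one_ereal_def)

lemma K1_eq_scaled_mean:
  "K1 l v = scaled_mean 0 (2 powr (2 * gam l) * Gamma (2 - 2 * gam l) / (Gamma (1 - gam l))\<^sup>2)
    (euler_weight (1 - gam l)) l v"
  by (simp add: fun_eq_iff K1_def scaled_mean_def weighted_mean_def euler_weight_def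
      interval_lebesgue_integral_def zero_ereal_def one_ereal_def mult_ac)

theorem corollary1p7:
  fixes l :: real and m :: nat
    and \<Omega> :: "((real^'n) \<times> real) set"
    and a :: "('n \<Rightarrow> nat) \<Rightarrow> real^'n \<Rightarrow> 'k::{real_normed_field, euclidean_space}"
    and v :: "(real^'n) \<times> real \<Rightarrow> 'k"
  assumes "0 < l"
    and "open \<Omega>" and "connected \<Omega>" and "\<Omega> \<subseteq> upper_half_space"
    and "backward_time_connected \<Omega>"
    and "\<And>\<alpha>. \<alpha> \<in> multi_indices m \<Longrightarrow> smooth_on (fst ` \<Omega>) (a \<alpha>)"
    and "Cm2_closure m (phi_image l \<Omega>) v"
    and "\<And>p. p \<in> phi_image l \<Omega> \<Longrightarrow> partial_t (partial_t v) p - diff_op m a v p = 0"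
  shows "Cm2 m \<Omega> (K0 l v) \<and> Cm2 m \<Omega> (K1 l v) \<and>
    (\<forall>(x, t)\<in>\<Omega>.
      partial_t (partial_t (K0 l v)) (x, t) - (t powr l) *\<^sub>R diff_op m a (K0 l v) (x, t)
        = (a_const l * t powr (l / 2 - 1)) *\<^sub>R initial_value (phi_image l \<Omega>) (partial_t v) x) \<and>
    (\<forall>(x, t)\<in>\<Omega>.
      partial_t (partial_t (K1 l v)) (x, t) - (t powr l) *\<^sub>R diff_op m a (K1 l v) (x, t)
        = (b_const l * t powr (l / 2)) *\<^sub>R initial_value (phi_image l \<Omega>) (partial_t v) x) \<and>
    (\<forall>x\<in>fst ` \<Omega>.
      (K0 l v \<longlongrightarrow> initial_value (phi_image l \<Omega>) v x) (at (x, 0) within \<Omega>) \<and>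
      (partial_t (K0 l v) \<longlongrightarrow> 0) (at (x, 0) within \<Omega>) \<and>
      (K1 l v \<longlongrightarrow> 0) (at (x, 0) within \<Omega>) \<and>
      (partial_t (K1 l v) \<longlongrightarrow> initial_value (phi_image l \<Omega>) v x) (at (x, 0) within \<Omega>))"
proof -
  interpret backward_domain l \<Omega>
    by unfold_locales (use assms in auto)
  let ?\<gamma> = "gam l"
  have \<gamma>: "0 < ?\<gamma>" "0 < 1 - ?\<gamma>" using l_pos by (simp_all add: gam_def field_simps)
  have \<gamma>_l: "?\<gamma> * (l + 2) = l / 2" using l_pos by (simp add: gam_def field_simps)
  then have \<gamma>_l': "(1 - ?\<gamma>) * (l + 2) = l / 2 + 2" by (simp add: algebra_simps)
  note w0 = euler_weight_integral[OF \<gamma>(1)] and w1 = euler_weight_integral[OF \<gamma>(2)]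
  note v = assms(7) and eq = assms(8)
  define c0 where "c0 = 2 powr (2 - 2 * ?\<gamma>) * Gamma (2 * ?\<gamma>) / (Gamma ?\<gamma>)\<^sup>2"
  define c1 where "c1 = 2 powr (2 * ?\<gamma>) * Gamma (2 - 2 * ?\<gamma>) / (Gamma (1 - ?\<gamma>))\<^sup>2"
  note K0 = K0_eq_scaled_mean[of l v, folded c0_def] and K1 = K1_eq_scaled_mean[of l v, folded c1_def]
  have Gamma_nz: "Gamma x \<noteq> 0" if "0 < x" for x :: real
    using Gamma_real_pos[OF that] by simp
  have norm0: "c0 * (LINT s:{0<..<1}|lborel. euler_weight ?\<gamma> s) = 1"
    unfolding c0_def w0(2) using Gamma_nz[of ?\<gamma>] Gamma_nz[of "2 * ?\<gamma>"] \<gamma>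
    by (simp add: powr_diff)
  have norm1: "c1 * (LINT s:{0<..<1}|lborel. euler_weight (1 - ?\<gamma>) s) = 1"
    unfolding c1_def w1(2) using Gamma_nz[of "1 - ?\<gamma>"] Gamma_nz[of "2 - 2 * ?\<gamma>"] \<gamma>
    by (simp add: algebra_simps powr_minus)
  have const0: "c0 * ((l + 2) / 2) = a_const l"
  proof -
    have "l / (2 * ?\<gamma>) = l + 2" using l_pos by (simp add: gam_def)
    moreover have "(2::real) powr (2 - 2 * ?\<gamma>) = 2 * 2 powr (1 - 2 * ?\<gamma>)"
      by (simp add: powr_diff)
    moreover have "a_const l = 2 powr (1 - 2 * ?\<gamma>) * (l / (2 * ?\<gamma>)) * Gamma (2 * ?\<gamma>) / (Gamma ?\<gamma>)\<^sup>2"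
      by (simp add: a_const_def)
    ultimately show ?thesis by (simp add: c0_def mult_ac)
  qed
  have const1: "c1 * ((l + 2) / 2) = b_const l"
    unfolding c1_def b_const_def by (simp add: powr_diff mult_ac)
  have eq0: "partial_t (partial_t (K0 l v)) (x, t) - (t powr l) *\<^sub>R diff_op m a (K0 l v) (x, t)
      = (a_const l * t powr (l / 2 - 1)) *\<^sub>R initial_value U (partial_t v) x" if "(x, t) \<in> \<Omega>" for x t
    using scaled_mean_equation[OF \<gamma>(1) v eq that, of c0 0] \<gamma>_l const0 by (simp add: K0)
  have eq1: "partial_t (partial_t (K1 l v)) (x, t) - (t powr l) *\<^sub>R diff_op m a (K1 l v) (x, t)
      = (b_const l * t powr (l / 2)) *\<^sub>R initial_value U (partial_t v) x" if p: "(x, t) \<in> \<Omega>" for x t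
  proof -
    have "t powr (l / 2) = t * t powr (l / 2 - 1)"
      using time_pos[OF p] by (simp add: powr_mult_base)
    then have "c1 * t * ((l + 2) / 2) * t powr (l / 2 - 1) = b_const l * t powr (l / 2)"
      by (simp add: const1[symmetric])
    then show ?thesis
      using scaled_mean_equation[OF \<gamma>(2) v eq p, of 0 c1] \<gamma>_l' by (simp add: K1)
  qed
  note ini0 = scaled_mean_initial_values[OF w0(1) v, of _ c0 0, folded K0, unfolded norm0]
    and ini1 = scaled_mean_initial_values[OF w1(1) v, of _ 0 c1, folded K1, unfolded norm1]
  have "Cm2 m \<Omega> (K0 l v)" "Cm2 m \<Omega> (K1 l v)"
    unfolding K0 K1 by (intro Cm2_scaled_mean w0 w1 v)+
  then show ?thesis
    using ini0 ini1 by (auto simp: eq0 eq1)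
qed

end
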